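(* (Soundness) For every set $\Gamma\cup\{\phi\}$ of $\mathbf{FOT}$-formulas, if $\Gamma\vdash_{\mathbf{FOT}}\phi$ then $\Gamma\models\phi$.
   Context: Vocabularies are first-order with equality; every model $M$ (its domain is also written $M$) has at least two elements. A team $X$ of $M$ over a set $V$ of variables is a set of assignments $s:V\to M$; $X(a/x)=\{s(a/x)\mid s\in X\}$, with $s(a/x)$ being $s$ modified or extended to send $x$ to $a$. Barred letters denote finite sequences. $\mathbf{FOT}$: $\phi::=\lambda\mid \bar x\subseteq\bar y\mid\dot\sim\phi\mid\phi\wedge\phi\mid\phi\vee^1\phi\mid\exists^1x\phi\mid\forall^1x\phi$ ($\lambda$ a first-order atom; $\bar x,\bar y$ variable sequences of equal length). $M\models_X\lambda$ iff $M\models_s\lambda$ for all $s\in X$; $M\models_X\bar x\subseteq\bar y$ iff for all $s\in X$ there is $s'\in X$ with $s(\bar x)=s'(\bar y)$; $M\models_X\dot\sim\phi$ iff $X=\emptyset$ or $M\not\models_X\phi$; $\wedge$ is conjunction; $M\models_X\phi\vee^1\psi$ iff $M\models_X\phi$ or $M\models_X\psi$; $M\models_X\exists^1x\phi$ (resp. $\forall^1x\phi$) iff $M\models_{X(a/x)}\phi$ for some (resp. all) $a\in M$. $\Gamma\models\phi$: for all $M$ and teams $X$ whose domain contains the free variables, if $M\models_X\psi$ for all $\psi\in\Gamma$ then $M\models_X\phi$. Abbreviations: $=\!(\bar t)$ is $\exists^1\bar x(\bar x=\bar t)$ with $\bar x$ fresh; an inclusion atom with constant symbols as arguments, e.g.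 $c\bar x\subseteq v\bar y$, is short for $\exists^1u(u=c\wedge u\bar x\subseteq v\bar y)$, $u$ fresh; $\bot$ is $\exists^1x\,\dot\sim(x=x)$. Substituted terms are assumed free for the variables replaced. Fresh constant and relation symbols are always available in derivations. The natural deduction system ($\Gamma\vdash_{\mathbf{FOT}}\phi$, written $\Gamma\vdash\phi$) has the rules: - $\Gamma\vdash\phi$ if $\phi\in\Gamma$. $\Gamma\vdash t=t$. From $\Gamma\vdash t=t'$ and $\Gamma\vdash\phi(t/x)$ infer $\Gamma\vdash\phi(t'/x)$. - $\wedge$-introduction and both $\wedge$-eliminations. From $\Gamma\vdash\phi$ infer $\Gamma\vdash\phi\vee^1\psi$ and $\Gamma\vdash\psi\vee^1\phi$. From $\Gamma\vdash\phi\vee^1\psi$, $\Gamma,\phi\vdash\chi$, $\Gamma,\psi\vdash\chi$ infer $\Gamma\vdash\chi$. - From $\Gamma\vdash\phi(t/x)$ and $\Gamma\vdash{=\!(t)}$ infer $\Gamma\vdash\exists^1x\phi$. From $\Gamma\vdash\exists^1x\phi$ and $\Gamma,\phi(v/x),{=\!(v)}\vdash\psi$ infer $\Gamma\vdash\psi$, if $v\notin\mathsf{Fv}(\Gamma\cup\{\phi,\psi\})$. From $\Gamma\vdash\exists^1x\phi$ and $\Gamma,\phi(c/x)\vdash\psi$ infer $\Gamma\vdash\psi$, if the constant symbol $c$ does not occur in $\Gamma,\phi,\psi$. - From $\Gamma,{=\!(v)}\vdash\phi(v/x)$ infer $\Gamma\vdash\forall^1x\phi$, if $v\notin\mathsf{Fv}(\Gamma\cup\{\phi\})$.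 From $\Gamma\vdash\phi(c/x)$ infer $\Gamma\vdash\forall^1x\phi$, if $c$ does not occur in $\Gamma,\phi$. From $\Gamma\vdash\forall^1x\phi$ and $\Gamma\vdash{=\!(t)}$ infer $\Gamma\vdash\phi(t/x)$. - From $\Gamma,\phi\vdash\bot$ infer $\Gamma\vdash\dot\sim\phi$. From $\Gamma\vdash\phi$ and $\Gamma\vdash\dot\sim\phi$ infer $\Gamma\vdash\psi$. From $\Gamma,\dot\sim\phi\vdash\bot$ infer $\Gamma\vdash\phi$. - $\Gamma\vdash{=\!(\bar c)}$ for constant symbols $\bar c$. From $\Gamma\vdash{=\!(\bar t)}$ infer $\Gamma\vdash{=\!(f\bar t)}$ for a function symbol $f$. - $\Gamma\vdash\bar x\subseteq\bar x$. From $\Gamma\vdash\bar x\subseteq\bar y$ and $\Gamma\vdash\bar y\subseteq\bar z$ infer $\Gamma\vdash\bar x\subseteq\bar z$. From $\Gamma\vdash x_1\dots x_n\subseteq y_1\dots y_n$ infer $\Gamma\vdash x_{i_1}\dots x_{i_k}\subseteq y_{i_1}\dots y_{i_k}$ for $\{i_1,\dots,i_k\}\subseteq\{1,\dots,n\}$. - From $\Gamma\vdash\bar x\subseteq\bar y$ and $\Gamma\vdash\alpha(\bar y/\bar z)$ infer $\Gamma\vdash\alpha(\bar x/\bar z)$, if $\alpha$ contains neither $\dot\sim$ nor inclusion atoms and its free variables are among $\bar z$. - From $\Gamma\vdash{=\!(\bar x)}$ and $\Gamma\vdash\bar y\subseteq\bar z$ infer $\Gamma\vdash\bar x\bar y\subseteq\bar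 x\bar z$. From $\Gamma\vdash{=\!(\bar x)}$ and $\Gamma\vdash\bar x\subseteq\bar y$ infer $\Gamma\vdash\exists^1\bar z(\bar z\bar x\subseteq\bar w\bar y)$ ($\bar z$ fresh). - From $\Gamma\vdash\dot\sim\,\bar x\subseteq\bar y$ and $\Gamma,\bar c\subseteq\bar x,\dot\sim\,\bar c\subseteq\bar y\vdash\phi$ infer $\Gamma\vdash\phi$; from $\Gamma\vdash\dot\sim\lambda(\bar x)$ and $\Gamma,\bar c\subseteq\bar x,\dot\sim\lambda(\bar c)\vdash\phi$ infer $\Gamma\vdash\phi$; in both, $\bar c$ are constant symbols not occurring in $\Gamma$ or $\phi$, and $\lambda$ is a first-order atom. - From $\Gamma,\exists^1\bar zR\bar z,\phi(R)\vdash\bot$ infer $\Gamma,\phi(\bar v)\vdash\bot$, where $\Gamma$ is a set of sentences in which $R$ does not occur, $\phi(R)$ is an inclusion-atom-free sentence in which $R$ occurs only in the form $R\bar x$ ($\bar x$ variables), and $\phi(\bar v)$ is the formula with free variables $\bar v$ obtained from $\phi(R)$ by replacing every $R\bar x$ by $\bar x\subseteq\bar v$.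
   Formalization: The two rules for negated atoms require the fresh constants c̄ to be pairwise distinct and, in the rule for λ, not to occur in λ; in the rule replacing R by inclusion, the inserted v̄ must not be captured by quantifiers. Without these conditions the system is unsound. *)

theory Defs
  imports Main
begin

section \<open>Vocabularies, terms and formulas\<close>

text \<open>
  A vocabulary is a pair of partial arity maps; a symbol with arity \<open>None\<close> does not belong to it.
  Constant symbols are the function symbols of arity 0. Variables are natural numbers.
\<close>

record ('f, 'r) vocab =
  fun_arity :: "'f \<Rightarrow> nat option"
  rel_arity :: "'r \<Rightarrow> nat option"

datatype (tm_funs: 'f) tm = Var nat | Fun 'f "'f tm list"

abbreviation Const :: "'f \<Rightarrow> 'f tm" where
  "Const c \<equiv> Fun c []"

datatype (fm_funs: 'f, fm_rels: 'r) fm =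
    Eq "'f tm" "'f tm"
  | Rel 'r "'f tm list"
  | Incl "nat list" "nat list"
  | Neg "('f, 'r) fm"
  | And "('f, 'r) fm" "('f, 'r) fm"
  | Or1 "('f, 'r) fm" "('f, 'r) fm"
  | Ex1 nat "('f, 'r) fm"
  | All1 nat "('f, 'r) fm"

fun tvars :: "'f tm \<Rightarrow> nat set" where
  "tvars (Var x) = {x}"
| "tvars (Fun f ts) = (\<Union>t\<in>set ts. tvars t)"

fun fv :: "('f, 'r) fm \<Rightarrow> nat set" where
  "fv (Eq t t') = tvars t \<union> tvars t'"
| "fv (Rel r ts) = (\<Union>t\<in>set ts. tvars t)"
| "fv (Incl xs ys) = set xs \<union> set ys"
| "fv (Neg \<phi>) = fv \<phi>"
| "fv (And \<phi> \<psi>) = fv \<phi> \<union> fv \<psi>"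
| "fv (Or1 \<phi> \<psi>) = fv \<phi> \<union> fv \<psi>"
| "fv (Ex1 x \<phi>) = fv \<phi> - {x}"
| "fv (All1 x \<phi>) = fv \<phi> - {x}"

fun wf_tm :: "('f, 'r) vocab \<Rightarrow> 'f tm \<Rightarrow> bool" where
  "wf_tm L (Var x) \<longleftrightarrow> True"
| "wf_tm L (Fun f ts) \<longleftrightarrow> fun_arity L f = Some (length ts) \<and> (\<forall>t\<in>set ts. wf_tm L t)"

fun wf_fm :: "('f, 'r) vocab \<Rightarrow> ('f, 'r) fm \<Rightarrow> bool" where
  "wf_fm L (Eq t t') \<longleftrightarrow> wf_tm L t \<and> wf_tm L t'"
| "wf_fm L (Rel r ts) \<longleftrightarrow> rel_arity L r = Some (length ts) \<and> (\<forall>t\<in>set ts. wf_tm L t)"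
| "wf_fm L (Incl xs ys) \<longleftrightarrow> length xs = length ys"
| "wf_fm L (Neg \<phi>) \<longleftrightarrow> wf_fm L \<phi>"
| "wf_fm L (And \<phi> \<psi>) \<longleftrightarrow> wf_fm L \<phi> \<and> wf_fm L \<psi>"
| "wf_fm L (Or1 \<phi> \<psi>) \<longleftrightarrow> wf_fm L \<phi> \<and> wf_fm L \<psi>"
| "wf_fm L (Ex1 x \<phi>) \<longleftrightarrow> wf_fm L \<phi>"
| "wf_fm L (All1 x \<phi>) \<longleftrightarrow> wf_fm L \<phi>"

definition FOT :: "('f, 'r) vocab \<Rightarrow> ('f, 'r) fm set" where
  "FOT L = {\<phi>. wf_fm L \<phi>}"

definition is_atom :: "('f, 'r) fm \<Rightarrow> bool" where
  "is_atom \<phi> \<longleftrightarrow> (\<exists>t t'. \<phi> = Eq t t') \<or> (\<exists>r ts. \<phi> = Rel r ts)"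

text \<open>Formulas with neither \<open>Neg\<close> nor inclusion atoms:\<close>

fun neg_incl_free :: "('f, 'r) fm \<Rightarrow> bool" where
  "neg_incl_free (Eq t t') \<longleftrightarrow> True"
| "neg_incl_free (Rel r ts) \<longleftrightarrow> True"
| "neg_incl_free (Incl xs ys) \<longleftrightarrow> False"
| "neg_incl_free (Neg \<phi>) \<longleftrightarrow> False"
| "neg_incl_free (And \<phi> \<psi>) \<longleftrightarrow> neg_incl_free \<phi> \<and> neg_incl_free \<psi>"
| "neg_incl_free (Or1 \<phi> \<psi>) \<longleftrightarrow> neg_incl_free \<phi> \<and> neg_incl_free \<psi>"
| "neg_incl_free (Ex1 x \<phi>) \<longleftrightarrow> neg_incl_free \<phi>"
| "neg_incl_free (All1 x \<phi>) \<longleftrightarrow> neg_incl_free \<phi>"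


section \<open>Team semantics\<close>

record ('f, 'r, 'a) model =
  Dom :: "'a set"
  fun_int :: "'f \<Rightarrow> 'a list \<Rightarrow> 'a"
  rel_int :: "'r \<Rightarrow> 'a list \<Rightarrow> bool"

definition is_model :: "('f, 'r) vocab \<Rightarrow> ('f, 'r, 'a) model \<Rightarrow> bool" where
  "is_model L M \<longleftrightarrow>
     (\<exists>a\<in>Dom M. \<exists>b\<in>Dom M. a \<noteq> b) \<and>
     (\<forall>f as. fun_arity L f = Some (length as) \<and> set as \<subseteq> Dom M \<longrightarrow> fun_int M f as \<in> Dom M)"

text \<open>Assignments are partial maps whose domain is the domain of the team.\<close>

type_synonym 'a assignment = "nat \<rightharpoonup> 'a"

definition is_team :: "('f, 'r, 'a) model \<Rightarrow> nat set \<Rightarrow> 'a assignment set \<Rightarrow> bool" where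
  "is_team M V X \<longleftrightarrow> (\<forall>s\<in>X. dom s = V \<and> ran s \<subseteq> Dom M)"

definition team_upd :: "'a assignment set \<Rightarrow> nat \<Rightarrow> 'a \<Rightarrow> 'a assignment set" where
  "team_upd X x a = {s(x \<mapsto> a) | s. s \<in> X}"

fun tval :: "('f, 'r, 'a) model \<Rightarrow> 'a assignment \<Rightarrow> 'f tm \<Rightarrow> 'a" where
  "tval M s (Var x) = the (s x)"
| "tval M s (Fun f ts) = fun_int M f (map (tval M s) ts)"

fun sat :: "('f, 'r, 'a) model \<Rightarrow> 'a assignment set \<Rightarrow> ('f, 'r) fm \<Rightarrow> bool" where
  "sat M X (Eq t t') \<longleftrightarrow> (\<forall>s\<in>X. tval M s t = tval M s t')"
| "sat M X (Rel r ts) \<longleftrightarrow> (\<forall>s\<in>X. rel_int M r (map (tval M s) ts))"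
| "sat M X (Incl xs ys) \<longleftrightarrow> (\<forall>s\<in>X. \<exists>s'\<in>X. map s xs = map s' ys)"
| "sat M X (Neg \<phi>) \<longleftrightarrow> X = {} \<or> \<not> sat M X \<phi>"
| "sat M X (And \<phi> \<psi>) \<longleftrightarrow> sat M X \<phi> \<and> sat M X \<psi>"
| "sat M X (Or1 \<phi> \<psi>) \<longleftrightarrow> sat M X \<phi> \<or> sat M X \<psi>"
| "sat M X (Ex1 x \<phi>) \<longleftrightarrow> (\<exists>a\<in>Dom M. sat M (team_upd X x a) \<phi>)"
| "sat M X (All1 x \<phi>) \<longleftrightarrow> (\<forall>a\<in>Dom M. sat M (team_upd X x a) \<phi>)"

text \<open>
  HOL cannot quantify over types inside a formula, so the type containing the domains of the models
  is an explicit argument; \<open>\<Gamma> \<Turnstile> \<phi>\<close> is this property for every type \<open>'a\<close>.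
\<close>

definition entails ::
    "'a itself \<Rightarrow> ('f, 'r) vocab \<Rightarrow> ('f, 'r) fm set \<Rightarrow> ('f, 'r) fm \<Rightarrow> bool" where
  "entails (_ :: 'a itself) L \<Gamma> \<phi> \<longleftrightarrow>
     (\<forall>(M :: ('f, 'r, 'a) model) V X.
        is_model L M \<and> is_team M V X \<and> (\<Union>\<psi>\<in>\<Gamma> \<union> {\<phi>}. fv \<psi>) \<subseteq> V \<and> (\<forall>\<psi>\<in>\<Gamma>. sat M X \<psi>)
        \<longrightarrow> sat M X \<phi>)"


section \<open>Abbreviations and substitution\<close>

definition Bot :: "('f, 'r) fm" where
  "Bot = Ex1 0 (Neg (Eq (Var 0) (Var 0)))"

abbreviation Ex1s :: "nat list \<Rightarrow> ('f, 'r) fm \<Rightarrow> ('f, 'r) fm" where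
  "Ex1s xs \<phi> \<equiv> foldr Ex1 xs \<phi>"

text \<open>The empty conjunction is rendered by a valid sentence.\<close>

fun conj_list :: "('f, 'r) fm list \<Rightarrow> ('f, 'r) fm" where
  "conj_list [] = Ex1 0 (Eq (Var 0) (Var 0))"
| "conj_list [\<phi>] = \<phi>"
| "conj_list (\<phi> # \<psi> # \<chi>s) = And \<phi> (conj_list (\<psi> # \<chi>s))"

text \<open>
  Abbreviations involving fresh bound variables are given as relations, so that every choice of
  fresh variables is admitted. \<open>is_constancy ts \<chi>\<close>: the formula \<open>\<chi>\<close> is \<open>=(ts)\<close>.
\<close>

definition is_constancy :: "'f tm list \<Rightarrow> ('f, 'r) fm \<Rightarrow> bool" where
  "is_constancy ts \<chi> \<longleftrightarrow>
     (\<exists>xs. length xs = length ts \<and> distinct xs \<and> set xs \<inter> (\<Union>t\<in>set ts. tvars t) = {} \<and>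
           \<chi> = Ex1s xs (conj_list (map2 (\<lambda>x t. Eq (Var x) t) xs ts)))"

fun tsubst :: "(nat \<Rightarrow> 'f tm) \<Rightarrow> 'f tm \<Rightarrow> 'f tm" where
  "tsubst \<sigma> (Var x) = \<sigma> x"
| "tsubst \<sigma> (Fun f ts) = Fun f (map (tsubst \<sigma>) ts)"

text \<open>
  \<open>is_incl ts ss \<chi>\<close>: the formula \<open>\<chi>\<close> is the inclusion atom \<open>ts \<subseteq> ss\<close> whose arguments are variables
  and constant symbols. The constant symbols are eliminated one after the other by
  \<open>\<exists>\<^sup>1u(u = c \<and> \<dots>)\<close>; the variable \<open>u\<close> no longer occurs in the arguments after \<open>c\<close> is put in its
  place, hence it is fresh.
\<close>

inductive is_incl :: "'f tm list \<Rightarrow> 'f tm list \<Rightarrow> ('f, 'r) fm \<Rightarrow> bool" where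
  vars: "is_incl (map Var xs) (map Var ys) (Incl xs ys)"
| const: "is_incl ts ss \<chi> \<Longrightarrow> u \<in> (\<Union>t\<in>set ts \<union> set ss. tvars t) \<Longrightarrow>
    is_incl (map (tsubst (Var(u := Const c))) ts) (map (tsubst (Var(u := Const c))) ss)
      (Ex1 u (And (Eq (Var u) (Const c)) \<chi>))"

text \<open>
  \<open>is_subst \<sigma> \<phi> \<psi>\<close>: the terms \<open>\<sigma> x\<close> are free for the variables \<open>x\<close> in \<open>\<phi>\<close>, and \<open>\<psi>\<close> is the result of
  simultaneously replacing the free occurrences of \<open>x\<close> by \<open>\<sigma> x\<close>. Variables in inclusion atoms can
  only be replaced by variables and constant symbols.
\<close>

inductive is_subst :: "(nat \<Rightarrow> 'f tm) \<Rightarrow> ('f, 'r) fm \<Rightarrow> ('f, 'r) fm \<Rightarrow> bool" where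
  "is_subst \<sigma> (Eq t t') (Eq (tsubst \<sigma> t) (tsubst \<sigma> t'))"
| "is_subst \<sigma> (Rel r ts) (Rel r (map (tsubst \<sigma>) ts))"
| "is_incl (map \<sigma> xs) (map \<sigma> ys) \<chi> \<Longrightarrow> is_subst \<sigma> (Incl xs ys) \<chi>"
| "is_subst \<sigma> \<phi> \<phi>' \<Longrightarrow> is_subst \<sigma> (Neg \<phi>) (Neg \<phi>')"
| "is_subst \<sigma> \<phi> \<phi>' \<Longrightarrow> is_subst \<sigma> \<psi> \<psi>' \<Longrightarrow> is_subst \<sigma> (And \<phi> \<psi>) (And \<phi>' \<psi>')"
| "is_subst \<sigma> \<phi> \<phi>' \<Longrightarrow> is_subst \<sigma> \<psi> \<psi>' \<Longrightarrow> is_subst \<sigma> (Or1 \<phi> \<psi>) (Or1 \<phi>' \<psi>')"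
| "is_subst (\<sigma>(y := Var y)) \<phi> \<phi>' \<Longrightarrow> \<forall>z\<in>fv \<phi> - {y}. y \<notin> tvars (\<sigma> z) \<Longrightarrow>
    is_subst \<sigma> (Ex1 y \<phi>) (Ex1 y \<phi>')"
| "is_subst (\<sigma>(y := Var y)) \<phi> \<phi>' \<Longrightarrow> \<forall>z\<in>fv \<phi> - {y}. y \<notin> tvars (\<sigma> z) \<Longrightarrow>
    is_subst \<sigma> (All1 y \<phi>) (All1 y \<phi>')"

abbreviation is_subst1 :: "nat \<Rightarrow> 'f tm \<Rightarrow> ('f, 'r) fm \<Rightarrow> ('f, 'r) fm \<Rightarrow> bool" where
  "is_subst1 x t \<phi> \<psi> \<equiv> is_subst (Var(x := t)) \<phi> \<psi>"

definition subst_of :: "nat list \<Rightarrow> 'f tm list \<Rightarrow> nat \<Rightarrow> 'f tm" where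
  "subst_of zs ts x = (case map_of (zip zs ts) x of None \<Rightarrow> Var x | Some t \<Rightarrow> t)"

text \<open>
  \<open>rel_to_incl R vs \<phi> \<psi>\<close>: the formula \<open>\<phi>\<close> is free of inclusion atoms, \<open>R\<close> occurs in it only in the
  form \<open>Rxs\<close> for variables \<open>xs\<close>, and \<open>\<psi>\<close> arises from \<open>\<phi>\<close> by replacing every \<open>Rxs\<close> by \<open>xs \<subseteq> vs\<close>,
  where the inserted occurrences of \<open>vs\<close> are free in \<open>\<psi>\<close>.
\<close>

inductive rel_to_incl :: "'r \<Rightarrow> nat list \<Rightarrow> ('f, 'r) fm \<Rightarrow> ('f, 'r) fm \<Rightarrow> bool" for R vs where
  "rel_to_incl R vs (Eq t t') (Eq t t')"
| "r \<noteq> R \<Longrightarrow> rel_to_incl R vs (Rel r ts) (Rel r ts)"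
| "rel_to_incl R vs (Rel R (map Var xs)) (Incl xs vs)"
| "rel_to_incl R vs \<phi> \<phi>' \<Longrightarrow> rel_to_incl R vs (Neg \<phi>) (Neg \<phi>')"
| "rel_to_incl R vs \<phi> \<phi>' \<Longrightarrow> rel_to_incl R vs \<psi> \<psi>' \<Longrightarrow>
    rel_to_incl R vs (And \<phi> \<psi>) (And \<phi>' \<psi>')"
| "rel_to_incl R vs \<phi> \<phi>' \<Longrightarrow> rel_to_incl R vs \<psi> \<psi>' \<Longrightarrow>
    rel_to_incl R vs (Or1 \<phi> \<psi>) (Or1 \<phi>' \<psi>')"
| "rel_to_incl R vs \<phi> \<phi>' \<Longrightarrow> R \<in> fm_rels \<phi> \<longrightarrow> y \<notin> set vs \<Longrightarrow>
    rel_to_incl R vs (Ex1 y \<phi>) (Ex1 y \<phi>')"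
| "rel_to_incl R vs \<phi> \<phi>' \<Longrightarrow> R \<in> fm_rels \<phi> \<longrightarrow> y \<notin> set vs \<Longrightarrow>
    rel_to_incl R vs (All1 y \<phi>) (All1 y \<phi>')"


section \<open>The natural deduction system\<close>

definition fresh_const :: "('f, 'r) vocab \<Rightarrow> ('f, 'r) fm set \<Rightarrow> 'f \<Rightarrow> bool" where
  "fresh_const W \<Delta> c \<longleftrightarrow> fun_arity W c = Some 0 \<and> (\<forall>\<psi>\<in>\<Delta>. c \<notin> fm_funs \<psi>)"

text \<open>
  The tuples \<open>cs\<close> of constant symbols in \<open>not_inclE\<close> and \<open>not_atomE\<close> consist of distinct symbols,
  and in \<open>not_atomE\<close> they do not occur in the atom \<open>\<theta>\<close> either; both rules are unsound otherwise.
  (If \<open>\<theta>\<close> could be \<open>x = c\<close>, the contradictory \<open>\<not> c = c\<close> would become available whenever \<open>x\<close> is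
  not constant.) In \<open>not_atomE\<close>, the variables of \<open>\<theta>\<close> are among the placeholders \<open>zs\<close>, and \<open>\<theta>(xs)\<close>,
  \<open>\<theta>(cs)\<close> are \<open>\<theta>(xs/zs)\<close>, \<open>\<theta>(cs/zs)\<close>. The premises on \<open>wf_tm\<close>, \<open>wf_fm\<close> and arities express that
  only terms and formulas of the vocabulary \<open>W\<close> are used.
\<close>

inductive deriv :: "('f, 'r) vocab \<Rightarrow> ('f, 'r) fm set \<Rightarrow> ('f, 'r) fm \<Rightarrow> bool" for W where
  assm:
    "\<phi> \<in> \<Gamma> \<Longrightarrow> deriv W \<Gamma> \<phi>"
| eq_refl:
    "wf_tm W t \<Longrightarrow> deriv W \<Gamma> (Eq t t)"
| eq_subst:
    "deriv W \<Gamma> (Eq t t') \<Longrightarrow> deriv W \<Gamma> \<psi> \<Longrightarrow> is_subst1 x t \<phi> \<psi> \<Longrightarrow> is_subst1 x t' \<phi> \<psi>' \<Longrightarrow>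
     deriv W \<Gamma> \<psi>'"
| andI:
    "deriv W \<Gamma> \<phi> \<Longrightarrow> deriv W \<Gamma> \<psi> \<Longrightarrow> deriv W \<Gamma> (And \<phi> \<psi>)"
| andE1:
    "deriv W \<Gamma> (And \<phi> \<psi>) \<Longrightarrow> deriv W \<Gamma> \<phi>"
| andE2:
    "deriv W \<Gamma> (And \<phi> \<psi>) \<Longrightarrow> deriv W \<Gamma> \<psi>"
| orI1:
    "deriv W \<Gamma> \<phi> \<Longrightarrow> wf_fm W \<psi> \<Longrightarrow> deriv W \<Gamma> (Or1 \<phi> \<psi>)"
| orI2:
    "deriv W \<Gamma> \<phi> \<Longrightarrow> wf_fm W \<psi> \<Longrightarrow> deriv W \<Gamma> (Or1 \<psi> \<phi>)"
| orE:
    "deriv W \<Gamma> (Or1 \<phi> \<psi>) \<Longrightarrow> deriv W (insert \<phi> \<Gamma>) \<chi> \<Longrightarrow> deriv W (insert \<psi> \<Gamma>) \<chi> \<Longrightarrow>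
     deriv W \<Gamma> \<chi>"
| exI1:
    "deriv W \<Gamma> \<psi> \<Longrightarrow> is_subst1 x t \<phi> \<psi> \<Longrightarrow> deriv W \<Gamma> \<chi> \<Longrightarrow> is_constancy [t] \<chi> \<Longrightarrow>
     deriv W \<Gamma> (Ex1 x \<phi>)"
| exE_var:
    "deriv W \<Gamma> (Ex1 x \<phi>) \<Longrightarrow> is_subst1 x (Var v) \<phi> \<phi>' \<Longrightarrow> is_constancy [Var v] \<chi> \<Longrightarrow>
     deriv W (insert \<chi> (insert \<phi>' \<Gamma>)) \<psi> \<Longrightarrow>
     v \<notin> (\<Union>\<theta>\<in>\<Gamma> \<union> {\<phi>, \<psi>}. fv \<theta>) \<Longrightarrow>
     deriv W \<Gamma> \<psi>"
| exE_const:
    "deriv W \<Gamma> (Ex1 x \<phi>) \<Longrightarrow> is_subst1 x (Const c) \<phi> \<phi>' \<Longrightarrow> deriv W (insert \<phi>' \<Gamma>) \<psi> \<Longrightarrow>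
     fresh_const W (\<Gamma> \<union> {\<phi>, \<psi>}) c \<Longrightarrow>
     deriv W \<Gamma> \<psi>"
| allI_var:
    "deriv W (insert \<chi> \<Gamma>) \<phi>' \<Longrightarrow> is_constancy [Var v] \<chi> \<Longrightarrow> is_subst1 x (Var v) \<phi> \<phi>' \<Longrightarrow>
     v \<notin> (\<Union>\<theta>\<in>\<Gamma> \<union> {\<phi>}. fv \<theta>) \<Longrightarrow>
     deriv W \<Gamma> (All1 x \<phi>)"
| allI_const:
    "deriv W \<Gamma> \<phi>' \<Longrightarrow> is_subst1 x (Const c) \<phi> \<phi>' \<Longrightarrow>
     fresh_const W (\<Gamma> \<union> {\<phi>}) c \<Longrightarrow>
     deriv W \<Gamma> (All1 x \<phi>)"
| allE1:
    "deriv W \<Gamma> (All1 x \<phi>) \<Longrightarrow> deriv W \<Gamma> \<chi> \<Longrightarrow> is_constancy [t] \<chi> \<Longrightarrow> is_subst1 x t \<phi> \<psi> \<Longrightarrow>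
     deriv W \<Gamma> \<psi>"
| negI:
    "wf_fm W \<phi> \<Longrightarrow> deriv W (insert \<phi> \<Gamma>) Bot \<Longrightarrow> deriv W \<Gamma> (Neg \<phi>)"
| negE:
    "deriv W \<Gamma> \<phi> \<Longrightarrow> deriv W \<Gamma> (Neg \<phi>) \<Longrightarrow> wf_fm W \<psi> \<Longrightarrow> deriv W \<Gamma> \<psi>"
| raa:
    "wf_fm W \<phi> \<Longrightarrow> deriv W (insert (Neg \<phi>) \<Gamma>) Bot \<Longrightarrow> deriv W \<Gamma> \<phi>"
| constancy_const:
    "\<forall>c\<in>set cs. fun_arity W c = Some 0 \<Longrightarrow> is_constancy (map Const cs) \<chi> \<Longrightarrow> deriv W \<Gamma> \<chi>"
| constancy_fun:
    "deriv W \<Gamma> \<chi> \<Longrightarrow> is_constancy ts \<chi> \<Longrightarrow> fun_arity W f = Some (length ts) \<Longrightarrow>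
     is_constancy [Fun f ts] \<chi>' \<Longrightarrow>
     deriv W \<Gamma> \<chi>'"
| incl_refl:
    "deriv W \<Gamma> (Incl xs xs)"
| incl_trans:
    "deriv W \<Gamma> (Incl xs ys) \<Longrightarrow> deriv W \<Gamma> (Incl ys zs) \<Longrightarrow> deriv W \<Gamma> (Incl xs zs)"
| incl_proj:
    "deriv W \<Gamma> (Incl xs ys) \<Longrightarrow> set js \<subseteq> {..<length xs} \<Longrightarrow>
     deriv W \<Gamma> (Incl (map (\<lambda>j. xs ! j) js) (map (\<lambda>j. ys ! j) js))"
| incl_compress:
    "deriv W \<Gamma> (Incl xs ys) \<Longrightarrow> deriv W \<Gamma> \<beta> \<Longrightarrow>
     neg_incl_free \<alpha> \<Longrightarrow> fv \<alpha> \<subseteq> set zs \<Longrightarrow> distinct zs \<Longrightarrow> length zs = length xs \<Longrightarrow>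
     is_subst (subst_of zs (map Var ys)) \<alpha> \<beta> \<Longrightarrow> is_subst (subst_of zs (map Var xs)) \<alpha> \<gamma> \<Longrightarrow>
     deriv W \<Gamma> \<gamma>"
| incl_constancy:
    "deriv W \<Gamma> \<chi> \<Longrightarrow> is_constancy (map Var xs) \<chi> \<Longrightarrow> deriv W \<Gamma> (Incl ys zs) \<Longrightarrow>
     deriv W \<Gamma> (Incl (xs @ ys) (xs @ zs))"
| incl_ext:
    "deriv W \<Gamma> \<chi> \<Longrightarrow> is_constancy (map Var xs) \<chi> \<Longrightarrow> deriv W \<Gamma> (Incl xs ys) \<Longrightarrow>
     length zs = length ws \<Longrightarrow> distinct zs \<Longrightarrow> set zs \<inter> (set xs \<union> set ys \<union> set ws) = {} \<Longrightarrow>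
     deriv W \<Gamma> (Ex1s zs (Incl (zs @ xs) (ws @ ys)))"
| not_inclE:
    "deriv W \<Gamma> (Neg (Incl xs ys)) \<Longrightarrow>
     is_incl (map Const cs) (map Var xs) \<alpha> \<Longrightarrow> is_incl (map Const cs) (map Var ys) \<beta> \<Longrightarrow>
     deriv W (insert (Neg \<beta>) (insert \<alpha> \<Gamma>)) \<phi> \<Longrightarrow>
     length cs = length xs \<Longrightarrow> distinct cs \<Longrightarrow> \<forall>c\<in>set cs. fresh_const W (\<Gamma> \<union> {\<phi>}) c \<Longrightarrow>
     deriv W \<Gamma> \<phi>"
| not_atomE:
    "is_atom \<theta> \<Longrightarrow> fv \<theta> \<subseteq> set zs \<Longrightarrow> distinct zs \<Longrightarrow> length xs = length zs \<Longrightarrow>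
     is_subst (subst_of zs (map Var xs)) \<theta> \<theta>\<^sub>x \<Longrightarrow> is_subst (subst_of zs (map Const cs)) \<theta> \<theta>\<^sub>c \<Longrightarrow>
     deriv W \<Gamma> (Neg \<theta>\<^sub>x) \<Longrightarrow>
     is_incl (map Const cs) (map Var xs) \<alpha> \<Longrightarrow>
     deriv W (insert (Neg \<theta>\<^sub>c) (insert \<alpha> \<Gamma>)) \<phi> \<Longrightarrow>
     length cs = length xs \<Longrightarrow> distinct cs \<Longrightarrow> \<forall>c\<in>set cs. fresh_const W (\<Gamma> \<union> {\<phi>, \<theta>}) c \<Longrightarrow>
     deriv W \<Gamma> \<phi>"
| rel_elim:
    "deriv W (insert \<phi> (insert (Ex1s zs (Rel R (map Var zs))) \<Gamma>)) Bot \<Longrightarrow>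
     rel_arity W R = Some (length vs) \<Longrightarrow> length zs = length vs \<Longrightarrow> distinct zs \<Longrightarrow>
     \<forall>\<gamma>\<in>\<Gamma>. fv \<gamma> = {} \<and> R \<notin> fm_rels \<gamma> \<Longrightarrow>
     wf_fm W \<phi> \<Longrightarrow> fv \<phi> = {} \<Longrightarrow> rel_to_incl R vs \<phi> \<psi> \<Longrightarrow>
     deriv W (insert \<psi> \<Gamma>) Bot"

text \<open>
  Derivations from formulas of \<open>L\<close> take place in the extension of \<open>L\<close> by infinitely many new constant
  symbols and infinitely many new relation symbols of each arity, so fresh symbols are available
  even if the premises use up all symbols of \<open>L\<close>. In \<open>NewRel n i\<close>, the number \<open>n\<close> is the arity.
\<close>

datatype 'f ext_fun = OldFun 'f | NewConst nat

datatype 'r ext_rel = OldRel 'r | NewRel nat nat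

definition ext_vocab :: "('f, 'r) vocab \<Rightarrow> ('f ext_fun, 'r ext_rel) vocab" where
  "ext_vocab L =
     \<lparr> fun_arity = case_ext_fun (fun_arity L) (\<lambda>i. Some 0),
       rel_arity = case_ext_rel (rel_arity L) (\<lambda>n i. Some n) \<rparr>"

abbreviation ext_fm :: "('f, 'r) fm \<Rightarrow> ('f ext_fun, 'r ext_rel) fm" where
  "ext_fm \<equiv> map_fm OldFun OldRel"

definition derives :: "('f, 'r) vocab \<Rightarrow> ('f, 'r) fm set \<Rightarrow> ('f, 'r) fm \<Rightarrow> bool" where
  "derives L \<Gamma> \<phi> \<longleftrightarrow> deriv (ext_vocab L) (ext_fm ` \<Gamma>) (ext_fm \<phi>)"

end

theory Submission
  imports Defs
begin

text \<open>
  Soundness is proved by induction on derivations. Two conventions keep side conditions out of the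
  induction. All teams have the set of all variables as their domain, so that formulas with arbitrary
  free variables can be evaluated, and all function symbols, even those outside the vocabulary, map
  tuples over the domain of the model into that domain, so that well-formedness need not be tracked.
  Neither convention loses anything: by locality (\<open>sat_cong_team\<close>) a team may be extended to all
  variables, and the interpretations of symbols outside the vocabulary may be chosen at will
  (\<open>sat_ext_model\<close>).

  The rules rest on a few properties of team semantics. The empty team satisfies every formula
  (\<open>sat_empty\<close>), so \<open>\<bottom>\<close> means that the team is empty and the weak negation
  behaves classically on the remaining teams. Substituting terms in a formula amounts to evaluating
  the formula in the team of the values of these terms (\<open>sat_subst\<close>); the formula \<open>=(t)\<close> says
  that \<open>t\<close> has a single value throughout the team (\<open>sat_constancy\<close>), in which case replacing \<open>x\<close> by
  \<open>t\<close> has the same effect as the single-valued quantifier step \<open>X(a/x)\<close>. A fresh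
  variable may therefore be reassigned, and a fresh constant symbol reinterpreted, as a name for a
  witness.

  The rules on negated atoms use that a failure of an inclusion atom or a first-order atom in a team
  is witnessed by one assignment \<open>s\<close> of it: the fresh constant symbols name the values of \<open>s\<close>. The
  compression rule holds because formulas without negation and inclusion atoms are closed under
  passing to subteams (\<open>sat_downward\<close>). In the last rule, \<open>R\<close> is interpreted as the set of values of
  \<open>vs\<close> in the team; the quantifiers of the formula never rebind \<open>vs\<close> above an occurrence of \<open>R\<close>, so
  that \<open>R xs\<close> and \<open>xs \<subseteq> vs\<close> stay equivalent under them (\<open>sat_rel_to_incl\<close>).
\<close>

section \<open>Teams and locality\<close>

lemma team_upd_image: "team_upd X x a = (\<lambda>s. s(x \<mapsto> a)) ` X"
  by (auto simp: team_upd_def)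

lemma team_upd_empty [simp]: "team_upd {} x a = {}"
  by (simp add: team_upd_def)

lemma team_upd_eq_empty_iff [simp]: "team_upd X x a = {} \<longleftrightarrow> X = {}"
  by (auto simp: team_upd_image)

definition full_team :: "('f, 'r, 'a) model \<Rightarrow> 'a assignment set \<Rightarrow> bool" where
  "full_team M X \<longleftrightarrow> is_team M UNIV X"

lemma full_teamD:
  assumes "full_team M X" "s \<in> X"
  shows "s x = Some (the (s x))" "the (s x) \<in> Dom M"
proof -
  have "x \<in> dom s" "ran s \<subseteq> Dom M"
    using assms by (auto simp: full_team_def is_team_def)
  then show "s x = Some (the (s x))" "the (s x) \<in> Dom M"
    by (auto simp: ran_def)
qed

lemma full_teamI:
  assumes "\<And>s x. s \<in> X \<Longrightarrow> \<exists>a\<in>Dom M. s x = Some a"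
  shows "full_team M X"
  unfolding full_team_def is_team_def
proof (intro ballI conjI)
  fix s assume s: "s \<in> X"
  show "dom s = UNIV" using assms[OF s] by blast
  show "ran s \<subseteq> Dom M"
  proof
    fix b assume "b \<in> ran s"
    then obtain x where "s x = Some b" by (auto simp: ran_def)
    then show "b \<in> Dom M" using assms[OF s, of x] by auto
  qed
qed

lemma full_team_upd:
  assumes "full_team M X" "a \<in> Dom M"
  shows "full_team M (team_upd X x a)"
proof (rule full_teamI)
  fix s y assume "s \<in> team_upd X x a"
  then obtain s0 where "s0 \<in> X" "s = s0(x \<mapsto> a)" by (auto simp: team_upd_image)
  then show "\<exists>b\<in>Dom M. s y = Some b"
    using full_teamD[OF assms(1), of s0 y] assms(2) by auto
qed

lemma full_team_cong: "Dom M = Dom N \<Longrightarrow> full_team M X \<longleftrightarrow> full_team N X"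
  by (simp add: full_team_def is_team_def)

lemma map_full_team_eq_iff:
  assumes "full_team M X" "s \<in> X" "s' \<in> X"
  shows "map s xs = map s' ys \<longleftrightarrow> map (\<lambda>x. the (s x)) xs = map (\<lambda>x. the (s' x)) ys"
proof -
  have "map s xs = map Some (map (\<lambda>x. the (s x)) xs)" "map s' ys = map Some (map (\<lambda>x. the (s' x)) ys)"
    using full_teamD(1)[OF assms(1)] assms by auto
  then show ?thesis by (metis inj_map_eq_map inj_Some)
qed

text \<open>
  One half of the statement that \<open>X\<close> and \<open>Y\<close> have the same restriction to \<open>V\<close>. The halves are kept
  apart because downward closure needs only one of them, while locality needs both.
\<close>

definition covered :: "nat set \<Rightarrow> 'a assignment set \<Rightarrow> 'a assignment set \<Rightarrow> bool" where
  "covered V X Y \<longleftrightarrow> (\<forall>s\<in>X. \<exists>s'\<in>Y. \<forall>x\<in>V. s x = s' x)"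

lemma covered_mono: "covered V X Y \<Longrightarrow> U \<subseteq> V \<Longrightarrow> covered U X Y"
  unfolding covered_def by (meson subsetD)

lemma covered_upd:
  assumes "covered (V - {x}) X Y"
  shows "covered V (team_upd X x a) (team_upd Y x a)"
  unfolding covered_def
proof
  fix s assume "s \<in> team_upd X x a"
  then obtain s0 where s0: "s0 \<in> X" "s = s0(x \<mapsto> a)" by (auto simp: team_upd_image)
  then obtain s1 where "s1 \<in> Y" "\<forall>y\<in>V - {x}. s0 y = s1 y"
    using assms unfolding covered_def by blast
  then have "s1(x \<mapsto> a) \<in> team_upd Y x a" "\<forall>y\<in>V. s y = (s1(x \<mapsto> a)) y"
    using s0 by (auto simp: team_upd_image)
  then show "\<exists>s'\<in>team_upd Y x a. \<forall>y\<in>V. s y = s' y" by blast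
qed

lemma covered_fresh_upd:
  assumes "x \<notin> V"
  shows "covered V X (team_upd X x a)" "covered V (team_upd X x a) X"
  using assms by (fastforce simp: covered_def team_upd_image)+

lemma covered_image: "(\<And>s x. s \<in> X \<Longrightarrow> x \<in> V \<Longrightarrow> f s x = g s x) \<Longrightarrow> covered V (f ` X) (g ` X)"
  by (auto simp: covered_def)

lemma covered_empty_iff: "covered V X Y \<Longrightarrow> covered V Y X \<Longrightarrow> X = {} \<longleftrightarrow> Y = {}"
  by (auto simp: covered_def)

lemma tval_cong: "(\<And>x. x \<in> tvars t \<Longrightarrow> s x = s' x) \<Longrightarrow> tval M s t = tval M s' t"
proof (induction t)
  case (Fun f ts)
  then have "map (tval M s) ts = map (tval M s') ts" by (auto intro!: map_cong)
  then show ?case by (simp only: tval.simps)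
qed simp

lemma sat_Eq_covered:
  assumes "covered (fv (Eq t t' :: ('f, 'r) fm)) X Y" "sat M Y (Eq t t' :: ('f, 'r) fm)"
  shows "sat M X (Eq t t' :: ('f, 'r) fm)"
proof -
  have "tval M s t = tval M s t'" if s: "s \<in> X" for s
  proof -
    obtain s' where s': "s' \<in> Y" "\<forall>x\<in>tvars t \<union> tvars t'. s x = s' x"
      using assms(1) s unfolding covered_def fv.simps by meson
    have "tval M s t = tval M s' t" "tval M s t' = tval M s' t'"
      using s'(2) by (auto intro!: tval_cong[of _ s s'])
    moreover have "tval M s' t = tval M s' t'" using assms(2) s'(1) by simp
    ultimately show ?thesis by simp
  qed
  then show ?thesis by simp
qed

lemma sat_Rel_covered:
  assumes "covered (fv (Rel r ts)) X Y" "sat M Y (Rel r ts)"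
  shows "sat M X (Rel r ts)"
proof -
  have "rel_int M r (map (tval M s) ts)" if s: "s \<in> X" for s
  proof -
    obtain s' where s': "s' \<in> Y" "\<forall>x\<in>(\<Union>t\<in>set ts. tvars t). s x = s' x"
      using assms(1) s unfolding covered_def fv.simps by meson
    have "tval M s t = tval M s' t" if "t \<in> set ts" for t
      using s'(2) that by (intro tval_cong) blast
    then have "map (tval M s) ts = map (tval M s') ts" by simp
    then show ?thesis using assms(2) s'(1) by (simp del: map_eq_conv)
  qed
  then show ?thesis by simp
qed

lemma sat_Incl_covered:
  assumes "covered (set xs \<union> set ys) X Y" "covered (set xs \<union> set ys) Y X" "sat M Y (Incl xs ys)"
  shows "sat M X (Incl xs ys)"
proof -
  have "\<exists>s'\<in>X. map s xs = map s' ys" if s: "s \<in> X" for s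
  proof -
    obtain s1 where s1: "s1 \<in> Y" "\<forall>x\<in>set xs \<union> set ys. s x = s1 x"
      using assms(1) s unfolding covered_def by blast
    obtain s2 where s2: "s2 \<in> Y" "map s1 xs = map s2 ys"
      using assms(3) s1(1) unfolding sat.simps by blast
    obtain s3 where s3: "s3 \<in> X" "\<forall>x\<in>set xs \<union> set ys. s2 x = s3 x"
      using assms(2) s2(1) unfolding covered_def by blast
    have "map s xs = map s1 xs" using s1(2) by simp
    also have "\<dots> = map s2 ys" by (rule s2(2))
    also have "\<dots> = map s3 ys" using s3(2) by simp
    finally show ?thesis using s3(1) by (rule bexI)
  qed
  then show ?thesis by simp
qed

text \<open>
  Locality. One inclusion between the restricted teams is not enough here: an inclusion atom may
  become false by removing assignments, and a negated formula by adding them.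
\<close>

lemma sat_cong_team:
  "covered (fv \<phi>) X Y \<Longrightarrow> covered (fv \<phi>) Y X \<Longrightarrow> sat M X \<phi> \<longleftrightarrow> sat M Y \<phi>"
proof (induction \<phi> arbitrary: X Y)
  case (Eq t t')
  show ?case by (rule iffI; rule sat_Eq_covered; (rule Eq.prems | assumption))
next
  case (Rel r ts)
  show ?case by (rule iffI; rule sat_Rel_covered; (rule Rel.prems | assumption))
next
  case (Incl xs ys)
  then have *: "covered (set xs \<union> set ys) X Y" "covered (set xs \<union> set ys) Y X" by simp_all
  show ?case by (rule iffI; rule sat_Incl_covered; (rule * | assumption))
next
  case (Neg \<phi>)
  have "X = {} \<longleftrightarrow> Y = {}" using covered_empty_iff[OF Neg.prems] .
  moreover have "sat M X \<phi> \<longleftrightarrow> sat M Y \<phi>" by (rule Neg.IH; use Neg.prems in simp)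
  ultimately show ?case by simp
next
  case (And \<phi> \<psi>)
  have "covered (fv \<phi>) X Y" "covered (fv \<phi>) Y X" "covered (fv \<psi>) X Y" "covered (fv \<psi>) Y X"
    by (rule covered_mono[OF And.prems(1)] covered_mono[OF And.prems(2)]; simp)+
  then show ?case using And.IH[of X Y] by simp
next
  case (Or1 \<phi> \<psi>)
  have "covered (fv \<phi>) X Y" "covered (fv \<phi>) Y X" "covered (fv \<psi>) X Y" "covered (fv \<psi>) Y X"
    by (rule covered_mono[OF Or1.prems(1)] covered_mono[OF Or1.prems(2)]; simp)+
  then show ?case using Or1.IH[of X Y] by simp
next
  case (Ex1 x \<phi>)
  have "sat M (team_upd X x a) \<phi> \<longleftrightarrow> sat M (team_upd Y x a) \<phi>" for a
    using Ex1.prems by (intro Ex1.IH covered_upd) simp_all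
  then show ?case by simp
next
  case (All1 x \<phi>)
  have "sat M (team_upd X x a) \<phi> \<longleftrightarrow> sat M (team_upd Y x a) \<phi>" for a
    using All1.prems by (intro All1.IH covered_upd) simp_all
  then show ?case by simp
qed

lemma sat_fresh_upd: "x \<notin> fv \<phi> \<Longrightarrow> sat M (team_upd X x a) \<phi> \<longleftrightarrow> sat M X \<phi>"
  by (intro sat_cong_team covered_fresh_upd)

text \<open>
  Without negation and inclusion atoms no assignment has to be present in the team, so assignments
  may be removed. Only restrictions to the free variables are compared because the teams in the
  compression rule are comparable only there.
\<close>

lemma sat_downward:
  "neg_incl_free \<alpha> \<Longrightarrow> covered (fv \<alpha>) X Y \<Longrightarrow> sat M Y \<alpha> \<Longrightarrow> sat M X \<alpha>"
proof (induction \<alpha> arbitrary: X Y)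
  case (Eq t t')
  show ?case by (rule sat_Eq_covered[OF Eq.prems(2,3)])
next
  case (Rel r ts)
  show ?case by (rule sat_Rel_covered[OF Rel.prems(2,3)])
next
  case (And \<phi> \<psi>)
  have "covered (fv \<phi>) X Y" "covered (fv \<psi>) X Y"
    by (rule covered_mono[OF And.prems(2)]; simp)+
  then show ?case using And.IH[of X Y] And.prems by auto
next
  case (Or1 \<phi> \<psi>)
  have "covered (fv \<phi>) X Y" "covered (fv \<psi>) X Y"
    by (rule covered_mono[OF Or1.prems(2)]; simp)+
  then show ?case using Or1.IH[of X Y] Or1.prems by auto
next
  case (Ex1 x \<phi>)
  have "sat M (team_upd X x a) \<phi>" if "sat M (team_upd Y x a) \<phi>" for a
    using that Ex1.prems by (intro Ex1.IH[of "team_upd X x a" "team_upd Y x a"] covered_upd) simp_all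
  then show ?case using Ex1.prems(3) by auto
next
  case (All1 x \<phi>)
  have "sat M (team_upd X x a) \<phi>" if "sat M (team_upd Y x a) \<phi>" for a
    using that All1.prems by (intro All1.IH[of "team_upd X x a" "team_upd Y x a"] covered_upd) simp_all
  then show ?case using All1.prems(3) by auto
qed auto


section \<open>Models\<close>

definition total_model :: "('f, 'r, 'a) model \<Rightarrow> bool" where
  "total_model M \<longleftrightarrow> Dom M \<noteq> {} \<and> (\<forall>f as. set as \<subseteq> Dom M \<longrightarrow> fun_int M f as \<in> Dom M)"

lemma total_model_const: "total_model M \<Longrightarrow> fun_int M c [] \<in> Dom M"
  by (simp add: total_model_def)

lemma sat_empty: "Dom M \<noteq> {} \<Longrightarrow> sat M {} \<phi>"
  by (induction \<phi>) auto

lemma sat_Bot: "Dom M \<noteq> {} \<Longrightarrow> sat M X Bot \<longleftrightarrow> X = {}"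
  by (auto simp: Bot_def)

lemma tval_cong_model:
  "(\<And>f. f \<in> tm_funs t \<Longrightarrow> fun_int M f = fun_int N f) \<Longrightarrow> tval M s t = tval N s t"
proof (induction t)
  case (Fun f ts)
  then have "map (tval M s) ts = map (tval N s) ts" by (auto intro!: map_cong)
  then show ?case using Fun.prems[of f] by (simp del: map_eq_conv)
qed simp

lemma sat_cong_model:
  assumes "Dom M = Dom N"
  shows "(\<And>f. f \<in> fm_funs \<phi> \<Longrightarrow> fun_int M f = fun_int N f) \<Longrightarrow>
    (\<And>r. r \<in> fm_rels \<phi> \<Longrightarrow> rel_int M r = rel_int N r) \<Longrightarrow> sat M X \<phi> \<longleftrightarrow> sat N X \<phi>"
proof (induction \<phi> arbitrary: X)
  case (Eq t t')
  have "tval M s t = tval N s t" "tval M s t' = tval N s t'" for s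
    using Eq(1) by (auto intro!: tval_cong_model[of _ M N])
  then show ?case by simp
next
  case (Rel r ts)
  have "map (tval M s) ts = map (tval N s) ts" for s
    using Rel(1) tval_cong_model[of _ M N s] by fastforce
  then show ?case using Rel(2)[of r] by (simp del: map_eq_conv)
qed (use assms in auto)

text \<open>
  The given symbols become names of the given elements. They are reinterpreted as constant functions
  of every arity, which is harmless for symbols that occur only as constant symbols.
\<close>

definition name_consts :: "('f, 'r, 'a) model \<Rightarrow> 'f list \<Rightarrow> 'a list \<Rightarrow> ('f, 'r, 'a) model" where
  "name_consts M cs as =
     M\<lparr>fun_int := \<lambda>f bs. case map_of (zip cs as) f of None \<Rightarrow> fun_int M f bs | Some a \<Rightarrow> a\<rparr>"

lemma name_consts_simps [simp]:
  "Dom (name_consts M cs as) = Dom M" "rel_int (name_consts M cs as) = rel_int M"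
  by (simp_all add: name_consts_def)

lemma total_name_consts:
  assumes "total_model M" "set as \<subseteq> Dom M"
  shows "total_model (name_consts M cs as)"
proof -
  have "a \<in> set as" if "map_of (zip cs as) f = Some a" for f a
    using map_of_SomeD[OF that] by (rule set_zip_rightD)
  then show ?thesis
    using assms by (auto simp: total_model_def name_consts_def split: option.split)
qed

lemma fun_int_name_consts_fresh:
  "f \<notin> set cs \<Longrightarrow> fun_int (name_consts M cs as) f = fun_int M f"
proof -
  assume "f \<notin> set cs"
  then have "map_of (zip cs as) f = None"
    by (auto simp: map_of_eq_None_iff dest: set_zip_leftD)
  then show ?thesis by (simp add: name_consts_def)
qed

lemma tval_name_consts:
  assumes "length cs = length as" "distinct cs"
  shows "map (tval (name_consts M cs as) s) (map Const cs) = as"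
proof (rule nth_equalityI)
  fix i assume i: "i < length (map (tval (name_consts M cs as) s) (map Const cs))"
  then have "map_of (zip cs as) (cs ! i) = Some (as ! i)"
    using assms by (simp add: map_of_zip_nth)
  then show "map (tval (name_consts M cs as) s) (map Const cs) ! i = as ! i"
    using i by (simp add: name_consts_def)
qed (use assms in simp)

lemma sat_name_consts:
  "\<forall>c\<in>set cs. c \<notin> fm_funs \<phi> \<Longrightarrow> sat (name_consts M cs as) X \<phi> \<longleftrightarrow> sat M X \<phi>"
  by (rule sat_cong_model) (auto intro: fun_int_name_consts_fresh)


section \<open>Substitution and the abbreviations\<close>

lemma tval_tsubst: "tval M s (tsubst \<sigma> t) = tval M (\<lambda>x. Some (tval M s (\<sigma> x))) t"
  by (induction t) (auto simp: comp_def cong: map_cong)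

lemma tval_tsubst_const:
  "tval M s (tsubst (Var(u := Const c)) t) = tval M (s(u \<mapsto> fun_int M c [])) t"
  unfolding tval_tsubst
proof -
  have "the (Some (tval M s ((Var(u := Const c)) x))) = the ((s(u \<mapsto> fun_int M c [])) x)" for x
    by simp
  then show "tval M (\<lambda>x. Some (tval M s ((Var(u := Const c)) x))) t =
      tval M (s(u \<mapsto> fun_int M c [])) t"
    by (induction t) (auto cong: map_cong)
qed

lemma sat_Ex1_Eq_Const:
  assumes "total_model M"
  shows "sat M X (Ex1 u (And (Eq (Var u) (Const c)) \<chi>)) \<longleftrightarrow> sat M (team_upd X u (fun_int M c [])) \<chi>"
proof (cases "X = {}")
  case True
  then show ?thesis using assms sat_empty[of M] by (auto simp: total_model_def)
next
  case False
  then have "(\<forall>s\<in>team_upd X u a. tval M s (Var u) = tval M s (Const c)) \<longleftrightarrow> a = fun_int M c []" for a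
    by (auto simp: team_upd_image)
  then show ?thesis using total_model_const[OF assms, of c] by (auto simp del: tval.simps)
qed

text \<open>
  The prefixes \<open>\<exists>\<^sup>1u(u = c \<and> \<dots>)\<close> leave no choice for \<open>u\<close> in a nonempty team, so that an inclusion
  atom with constant symbols compares the values of its arguments, just as one without them does.
\<close>

lemma sat_is_incl:
  assumes "total_model M"
  shows "is_incl ts ss \<chi> \<Longrightarrow> full_team M X \<Longrightarrow>
    sat M X \<chi> \<longleftrightarrow> (\<forall>s\<in>X. \<exists>s'\<in>X. map (tval M s) ts = map (tval M s') ss)"
proof (induction arbitrary: X rule: is_incl.induct)
  case (vars xs ys)
  then show ?case by (simp add: map_full_team_eq_iff comp_def)
next
  case (const ts ss \<chi> u c)
  let ?a = "fun_int M c []"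
  have "full_team M (team_upd X u ?a)"
    using const.prems assms by (simp add: full_team_upd total_model_const)
  then have "sat M (team_upd X u ?a) \<chi> \<longleftrightarrow>
      (\<forall>s\<in>X. \<exists>s'\<in>X. map (tval M (s(u \<mapsto> ?a))) ts = map (tval M (s'(u \<mapsto> ?a))) ss)"
    using const.IH by (simp add: team_upd_image)
  then show ?case
    unfolding sat_Ex1_Eq_Const[OF assms] by (simp add: tval_tsubst_const comp_def)
qed

definition subst_team ::
    "('f, 'r, 'a) model \<Rightarrow> (nat \<Rightarrow> 'f tm) \<Rightarrow> 'a assignment set \<Rightarrow> 'a assignment set" where
  "subst_team M \<sigma> X = (\<lambda>s x. Some (tval M s (\<sigma> x))) ` X"

lemma subst_team_eq_empty_iff [simp]: "subst_team M \<sigma> X = {} \<longleftrightarrow> X = {}"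
  by (simp add: subst_team_def)

text \<open>
  This is where freeness for substitution enters: on the free variables of the body, rebinding \<open>y\<close>
  does not change the values of the substituted terms.
\<close>

lemma sat_subst_team_upd:
  assumes "\<forall>z\<in>fv \<phi> - {y}. y \<notin> tvars (\<sigma> z)"
  shows "sat M (subst_team M (\<sigma>(y := Var y)) (team_upd X y a)) \<phi> \<longleftrightarrow>
    sat M (team_upd (subst_team M \<sigma> X) y a) \<phi>"
proof -
  let ?l = "\<lambda>s x. Some (tval M (s(y \<mapsto> a)) ((\<sigma>(y := Var y)) x))"
  let ?r = "\<lambda>s. (\<lambda>x. Some (tval M s (\<sigma> x)))(y \<mapsto> a)"
  have *: "?l s x = ?r s x" if "x \<in> fv \<phi>" for s x
  proof (cases "x = y")
    case False
    then have "y \<notin> tvars (\<sigma> x)" using assms that by blast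
    then have "tval M (s(y \<mapsto> a)) (\<sigma> x) = tval M s (\<sigma> x)" by (intro tval_cong) auto
    then show ?thesis using False by simp
  qed simp
  have l: "subst_team M (\<sigma>(y := Var y)) (team_upd X y a) = ?l ` X"
    by (simp add: subst_team_def team_upd_image image_image)
  have r: "team_upd (subst_team M \<sigma> X) y a = ?r ` X"
    by (simp add: subst_team_def team_upd_image image_image)
  show ?thesis unfolding l r
    by (rule sat_cong_team; rule covered_image; rule * *[symmetric])
qed

text \<open>
  The substitution lemma of first-order logic, assignment by assignment: it applies to teams because
  inclusion atoms compare the values of the substituted terms.
\<close>

lemma sat_subst:
  assumes "total_model M"
  shows "is_subst \<sigma> \<phi> \<psi> \<Longrightarrow> full_team M X \<Longrightarrow> sat M X \<psi> \<longleftrightarrow> sat M (subst_team M \<sigma> X) \<phi>"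
proof (induction arbitrary: X rule: is_subst.induct)
  case (1 \<sigma> t t')
  then show ?case by (simp add: subst_team_def tval_tsubst)
next
  case (2 \<sigma> r ts)
  then show ?case by (simp add: subst_team_def tval_tsubst comp_def)
next
  case (3 \<sigma> xs ys \<chi>)
  have "map (\<lambda>x. Some (tval M s (\<sigma> x))) xs = map (\<lambda>x. Some (tval M s' (\<sigma> x))) ys \<longleftrightarrow>
      map (tval M s) (map \<sigma> xs) = map (tval M s') (map \<sigma> ys)" for s s'
  proof -
    have "map (\<lambda>x. Some (tval M s (\<sigma> x))) zs = map Some (map (tval M s) (map \<sigma> zs))" for s zs
      by simp
    then show ?thesis by (metis inj_map_eq_map inj_Some)
  qed
  then show ?case
    using sat_is_incl[OF assms 3] by (simp add: subst_team_def)
next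
  case (7 \<sigma> y \<phi> \<phi>')
  have "sat M (team_upd X y a) \<phi>' \<longleftrightarrow> sat M (team_upd (subst_team M \<sigma> X) y a) \<phi>"
    if "a \<in> Dom M" for a
    using 7 that full_team_upd sat_subst_team_upd by metis
  then show ?case by simp
next
  case (8 \<sigma> y \<phi> \<phi>')
  have "sat M (team_upd X y a) \<phi>' \<longleftrightarrow> sat M (team_upd (subst_team M \<sigma> X) y a) \<phi>"
    if "a \<in> Dom M" for a
    using 8 that full_team_upd sat_subst_team_upd by metis
  then show ?case by simp
qed simp_all

lemma subst_team_constant:
  assumes "full_team M X" "\<forall>s\<in>X. tval M s t = a"
  shows "subst_team M (Var(x := t)) X = team_upd X x a"
proof -
  have "(\<lambda>y. Some (tval M s ((Var(x := t)) y))) = s(x \<mapsto> a)" if "s \<in> X" for s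
    using full_teamD(1)[OF assms(1) that] assms(2) that by (auto simp: fun_eq_iff)
  then show ?thesis by (auto simp: subst_team_def team_upd_image)
qed

lemma sat_subst1:
  assumes "total_model M" "full_team M X" "is_subst1 x t \<phi> \<psi>" "\<forall>s\<in>X. tval M s t = a"
  shows "sat M X \<psi> \<longleftrightarrow> sat M (team_upd X x a) \<phi>"
  using sat_subst[OF assms(1,3,2)] subst_team_constant[OF assms(2,4)] by simp

lemma sat_conj_list:
  "Dom M \<noteq> {} \<Longrightarrow> sat M X (conj_list \<phi>s) \<longleftrightarrow> (\<forall>\<phi>\<in>set \<phi>s. sat M X \<phi>)"
  by (induction \<phi>s rule: conj_list.induct) auto

lemma sat_Ex1s:
  "sat M X (Ex1s xs \<phi>) \<longleftrightarrow>
    (\<exists>as. length as = length xs \<and> set as \<subseteq> Dom M \<and> sat M ((\<lambda>s. s(xs [\<mapsto>] as)) ` X) \<phi>)"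
proof (induction xs arbitrary: X)
  case (Cons x xs)
  have "sat M X (Ex1s (x # xs) \<phi>) \<longleftrightarrow>
      (\<exists>a\<in>Dom M. \<exists>as. length as = length xs \<and> set as \<subseteq> Dom M \<and>
        sat M ((\<lambda>s. s(x # xs [\<mapsto>] a # as)) ` X) \<phi>)"
    using Cons.IH by (simp add: team_upd_image image_image)
  also have "\<dots> \<longleftrightarrow> (\<exists>as. length as = length (x # xs) \<and> set as \<subseteq> Dom M \<and>
        sat M ((\<lambda>s. s(x # xs [\<mapsto>] as)) ` X) \<phi>)" (is "?A \<longleftrightarrow> ?B")
  proof
    assume ?A
    then obtain a as where "a \<in> Dom M" "length as = length xs" "set as \<subseteq> Dom M"
        "sat M ((\<lambda>s. s(x # xs [\<mapsto>] a # as)) ` X) \<phi>" by blast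
    then show ?B by (intro exI[of _ "a # as"]) auto
  next
    assume ?B
    then obtain as where as: "length as = length (x # xs)" "set as \<subseteq> Dom M"
        "sat M ((\<lambda>s. s(x # xs [\<mapsto>] as)) ` X) \<phi>" by blast
    then obtain b bs where "as = b # bs" by (cases as) auto
    then show ?A using as by (intro bexI[of _ b] exI[of _ bs]) auto
  qed
  finally show ?case .
qed simp

lemma map_upds_values:
  assumes "distinct xs" "length as = length xs"
  shows "map (s(xs [\<mapsto>] as)) xs = map Some as"
  using assms
proof (induction xs arbitrary: s as)
  case (Cons x xs)
  then obtain b bs where "as = b # bs" by (cases as) auto
  then show ?case using Cons by (simp del: map_eq_conv map_upds_twist fun_upd_apply, simp)
qed simp

text \<open>
  The witnesses of \<open>\<exists>\<^sup>1\<close> are chosen once for the whole team, so \<open>\<exists>\<^sup>1xs(xs = ts)\<close> forces the values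
  of \<open>ts\<close> to be the same under all assignments.
\<close>

lemma sat_constancy:
  assumes "Dom M \<noteq> {}" "is_constancy ts \<chi>"
  shows "sat M X \<chi> \<longleftrightarrow> X = {} \<or> (\<exists>as. set as \<subseteq> Dom M \<and> (\<forall>s\<in>X. map (tval M s) ts = as))"
proof -
  obtain xs where xs: "length xs = length ts" "distinct xs" "set xs \<inter> (\<Union>t\<in>set ts. tvars t) = {}"
    and \<chi>: "\<chi> = Ex1s xs (conj_list (map2 (\<lambda>x t. Eq (Var x) t) xs ts))"
    using assms(2) unfolding is_constancy_def by blast
  have *: "(\<forall>\<phi>\<in>set (map2 (\<lambda>x t. Eq (Var x) t) xs ts). sat M ((\<lambda>s. s(xs [\<mapsto>] as)) ` X) \<phi>) \<longleftrightarrow>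
      (\<forall>s\<in>X. map (tval M s) ts = as)" if as: "length as = length xs" for as
  proof -
    have val: "tval M (s(xs [\<mapsto>] as)) t = tval M s t" if "t \<in> set ts" for s t
      using xs(3) that by (intro tval_cong) (auto intro!: map_upds_apply_nontin)
    have ev: "the ((s(xs [\<mapsto>] as)) (xs ! i)) = as ! i" if "i < length ts" for s i
    proof -
      have "map (s(xs [\<mapsto>] as)) xs ! i = map Some as ! i"
        using map_upds_values[OF xs(2) as, of s] by simp
      then show ?thesis using that as xs(1) by simp
    qed
    have "(\<forall>\<phi>\<in>set (map2 (\<lambda>x t. Eq (Var x) t) xs ts). sat M ((\<lambda>s. s(xs [\<mapsto>] as)) ` X) \<phi>) \<longleftrightarrow>
        (\<forall>i<length ts. sat M ((\<lambda>s. s(xs [\<mapsto>] as)) ` X) (Eq (Var (xs ! i)) (ts ! i)))"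
      using xs(1) by (simp add: all_set_conv_all_nth del: sat.simps)
    also have "\<dots> \<longleftrightarrow> (\<forall>i<length ts. \<forall>s\<in>X.
        the ((s(xs [\<mapsto>] as)) (xs ! i)) = tval M (s(xs [\<mapsto>] as)) (ts ! i))"
      by simp
    also have "\<dots> \<longleftrightarrow> (\<forall>i<length ts. \<forall>s\<in>X. as ! i = tval M s (ts ! i))"
      using val ev by auto
    also have "\<dots> \<longleftrightarrow> (\<forall>s\<in>X. map (tval M s) ts = as)"
      using as xs(1) by (auto simp: list_eq_iff_nth_eq)
    finally show ?thesis .
  qed
  have "sat M X \<chi> \<longleftrightarrow>
      (\<exists>as. length as = length xs \<and> set as \<subseteq> Dom M \<and> (\<forall>s\<in>X. map (tval M s) ts = as))"
    unfolding \<chi> sat_Ex1s sat_conj_list[OF assms(1)] using * by blast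
  also have "\<dots> \<longleftrightarrow> X = {} \<or> (\<exists>as. set as \<subseteq> Dom M \<and> (\<forall>s\<in>X. map (tval M s) ts = as))"
  proof (cases "X = {}")
    case True
    obtain a where "a \<in> Dom M" using assms(1) by blast
    then show ?thesis using True by (auto intro!: exI[of _ "replicate (length xs) a"])
  next
    case False
    then show ?thesis using xs(1) by (metis all_not_in_conv length_map)
  qed
  finally show ?thesis .
qed

lemma sat_constancy1:
  assumes "Dom M \<noteq> {}" "is_constancy [t] \<chi>"
  shows "sat M X \<chi> \<longleftrightarrow> X = {} \<or> (\<exists>a\<in>Dom M. \<forall>s\<in>X. tval M s t = a)"
proof -
  have "\<exists>a\<in>Dom M. \<forall>s\<in>X. tval M s t = a"
    if "s0 \<in> X" "set as \<subseteq> Dom M" "\<forall>s\<in>X. map (tval M s) [t] = as" for as s0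
  proof -
    have "as = [tval M s0 t]" using that(1,3) by simp
    then show ?thesis using that(2,3) by (intro bexI[of _ "tval M s0 t"]) auto
  qed
  moreover have "\<exists>as. set as \<subseteq> Dom M \<and> (\<forall>s\<in>X. map (tval M s) [t] = as)"
    if "a \<in> Dom M" "\<forall>s\<in>X. tval M s t = a" for a
    using that by (intro exI[of _ "[a]"]) simp
  ultimately show ?thesis unfolding sat_constancy[OF assms] by blast
qed

lemma subst_of_nth:
  "distinct zs \<Longrightarrow> length zs = length ts \<Longrightarrow> i < length zs \<Longrightarrow> subst_of zs ts (zs ! i) = ts ! i"
  by (simp add: subst_of_def map_of_zip_nth)

lemma map_subst_of:
  "distinct zs \<Longrightarrow> length zs = length ts \<Longrightarrow> map (subst_of zs ts) zs = ts"
  by (auto intro: nth_equalityI simp: subst_of_nth)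


section \<open>Soundness of the rules\<close>

definition seq_valid :: "'a itself \<Rightarrow> ('f, 'r) fm set \<Rightarrow> ('f, 'r) fm \<Rightarrow> bool" where
  "seq_valid (_ :: 'a itself) \<Gamma> \<phi> \<longleftrightarrow>
     (\<forall>(M :: ('f, 'r, 'a) model) X.
        total_model M \<and> full_team M X \<and> (\<forall>\<psi>\<in>\<Gamma>. sat M X \<psi>) \<longrightarrow> sat M X \<phi>)"

lemma seq_validD:
  fixes M :: "('f, 'r, 'a) model"
  shows "seq_valid TYPE('a) \<Gamma> \<phi> \<Longrightarrow> total_model M \<Longrightarrow> full_team M X \<Longrightarrow>
    \<forall>\<psi>\<in>\<Gamma>. sat M X \<psi> \<Longrightarrow> sat M X \<phi>"
  unfolding seq_valid_def by blast

text \<open>The empty team satisfies everything, so it may be set aside once and for all.\<close>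

lemma seq_validI:
  assumes "\<And>(M :: ('f, 'r, 'a) model) X. total_model M \<Longrightarrow> full_team M X \<Longrightarrow>
    \<forall>\<psi>\<in>\<Gamma>. sat M X \<psi> \<Longrightarrow> X \<noteq> {} \<Longrightarrow> sat M X \<phi>"
  shows "seq_valid TYPE('a) \<Gamma> \<phi>"
  unfolding seq_valid_def using assms sat_empty total_model_def by metis

text \<open>
  Giving \<open>v\<close> the value \<open>a\<close> throughout the team makes \<open>v\<close> constant, so \<open>\<phi>(v/x)\<close> says what \<open>\<phi>\<close> says
  about \<open>a\<close>. The variables \<open>v\<close> and \<open>x\<close> may coincide: both are assigned the same value.
\<close>

lemma sat_subst_fresh_var:
  assumes "total_model M" "full_team M X" "a \<in> Dom M"
    and "is_subst1 x (Var v) \<phi> \<phi>'" "v \<notin> fv \<phi>"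
  shows "sat M (team_upd X v a) \<phi>' \<longleftrightarrow> sat M (team_upd X x a) \<phi>"
proof -
  have "sat M (team_upd X v a) \<phi>' \<longleftrightarrow> sat M (team_upd (team_upd X v a) x a) \<phi>"
    using assms by (intro sat_subst1) (auto simp: full_team_upd, auto simp: team_upd_image)
  also have "team_upd (team_upd X v a) x a = team_upd (team_upd X x a) v a"
    by (cases "v = x") (auto simp: team_upd_image image_image fun_upd_twist)
  finally show ?thesis using sat_fresh_upd[OF assms(5)] by simp
qed

lemma sat_subst_fresh_const:
  assumes "total_model M" "full_team M X" "a \<in> Dom M"
    and "is_subst1 x (Const c) \<phi> \<phi>'" "c \<notin> fm_funs \<phi>"
  shows "sat (name_consts M [c] [a]) X \<phi>' \<longleftrightarrow> sat M (team_upd X x a) \<phi>"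
proof -
  let ?N = "name_consts M [c] [a]"
  have "total_model ?N" "full_team ?N X"
    using assms total_name_consts[of M "[a]" "[c]"] full_team_cong[of ?N M] by auto
  moreover have "\<forall>s\<in>X. tval ?N s (Const c) = a" by (simp add: name_consts_def)
  ultimately have "sat ?N X \<phi>' \<longleftrightarrow> sat ?N (team_upd X x a) \<phi>"
    using assms(4) by (intro sat_subst1)
  then show ?thesis using sat_name_consts[of "[c]" \<phi> M "[a]"] assms(5) by simp
qed

lemma fresh_constD: "fresh_const W \<Delta> c \<Longrightarrow> \<psi> \<in> \<Delta> \<Longrightarrow> c \<notin> fm_funs \<psi>"
  by (simp add: fresh_const_def)

text \<open>
  The eigenvariable is reassigned to a witness on the whole team. This makes \<open>=(v)\<close> true, and
  locality transfers the context to the modified team and the conclusion back.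
\<close>

lemma exE_var_sound:
  assumes ex: "seq_valid TYPE('a) \<Gamma> (Ex1 x \<phi>)" and sub: "is_subst1 x (Var v) \<phi> \<phi>'"
    and con: "is_constancy [Var v] \<chi>" and prem: "seq_valid TYPE('a) (insert \<chi> (insert \<phi>' \<Gamma>)) \<psi>"
    and fresh: "v \<notin> (\<Union>\<theta>\<in>\<Gamma> \<union> {\<phi>, \<psi>}. fv \<theta>)"
  shows "seq_valid TYPE('a) \<Gamma> \<psi>"
proof (rule seq_validI)
  fix M :: "('b, 'c, 'a) model" and X
  assume M: "total_model M" "full_team M X" and \<Gamma>: "\<forall>\<gamma>\<in>\<Gamma>. sat M X \<gamma>"
  obtain a where a: "a \<in> Dom M" "sat M (team_upd X x a) \<phi>"
    using seq_validD[OF ex M \<Gamma>] by auto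
  let ?Y = "team_upd X v a"
  have "sat M ?Y \<phi>'" using sat_subst_fresh_var[OF M a(1) sub] a(2) fresh by simp
  moreover have "sat M ?Y \<chi>"
    using a(1) by (subst sat_constancy1[OF _ con]) (auto simp: team_upd_image)
  moreover have "sat M ?Y \<gamma>" if "\<gamma> \<in> \<Gamma>" for \<gamma>
    using \<Gamma> fresh that by (auto simp: sat_fresh_upd)
  ultimately have "sat M ?Y \<psi>"
    using full_team_upd[OF M(2) a(1)] by (intro seq_validD[OF prem M(1)]) auto
  then show "sat M X \<psi>" using fresh by (simp add: sat_fresh_upd)
qed

text \<open>
  Here the team is kept and the model changes: the fresh constant symbol becomes a name of the
  witness.
\<close>

lemma exE_const_sound:
  assumes ex: "seq_valid TYPE('a) \<Gamma> (Ex1 x \<phi>)" and sub: "is_subst1 x (Const c) \<phi> \<phi>'"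
    and prem: "seq_valid TYPE('a) (insert \<phi>' \<Gamma>) \<psi>" and fresh: "fresh_const W (\<Gamma> \<union> {\<phi>, \<psi>}) c"
  shows "seq_valid TYPE('a) \<Gamma> \<psi>"
proof (rule seq_validI)
  fix M :: "('b, 'c, 'a) model" and X
  assume M: "total_model M" "full_team M X" and \<Gamma>: "\<forall>\<gamma>\<in>\<Gamma>. sat M X \<gamma>"
  obtain a where a: "a \<in> Dom M" "sat M (team_upd X x a) \<phi>"
    using seq_validD[OF ex M \<Gamma>] by auto
  let ?N = "name_consts M [c] [a]"
  have N: "total_model ?N" "full_team ?N X"
    using M a total_name_consts[of M "[a]" "[c]"] full_team_cong[of ?N M] by auto
  have same: "sat ?N X \<theta> \<longleftrightarrow> sat M X \<theta>" if "\<theta> \<in> \<Gamma> \<union> {\<phi>, \<psi>}" for \<theta>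
    using fresh_constD[OF fresh that] by (simp add: sat_name_consts)
  have "sat ?N X \<phi>'"
    using sat_subst_fresh_const[OF M a(1) sub] a(2) fresh_constD[OF fresh] by simp
  then have "sat ?N X \<psi>" using \<Gamma> same by (intro seq_validD[OF prem N]) auto
  then show "sat M X \<psi>" using same by simp
qed

lemma allI_var_sound:
  assumes prem: "seq_valid TYPE('a) (insert \<chi> \<Gamma>) \<phi>'" and con: "is_constancy [Var v] \<chi>"
    and sub: "is_subst1 x (Var v) \<phi> \<phi>'" and fresh: "v \<notin> (\<Union>\<theta>\<in>\<Gamma> \<union> {\<phi>}. fv \<theta>)"
  shows "seq_valid TYPE('a) \<Gamma> (All1 x \<phi>)"
proof (rule seq_validI)
  fix M :: "('b, 'c, 'a) model" and X
  assume M: "total_model M" "full_team M X" and \<Gamma>: "\<forall>\<gamma>\<in>\<Gamma>. sat M X \<gamma>"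
  have "sat M (team_upd X x a) \<phi>" if a: "a \<in> Dom M" for a
  proof -
    let ?Y = "team_upd X v a"
    have "sat M ?Y \<chi>"
      using a by (subst sat_constancy1[OF _ con]) (auto simp: team_upd_image)
    moreover have "sat M ?Y \<gamma>" if "\<gamma> \<in> \<Gamma>" for \<gamma>
      using \<Gamma> fresh that by (auto simp: sat_fresh_upd)
    ultimately have "sat M ?Y \<phi>'"
      using full_team_upd[OF M(2) a] by (intro seq_validD[OF prem M(1)]) auto
    then show ?thesis using sat_subst_fresh_var[OF M a sub] fresh by simp
  qed
  then show "sat M X (All1 x \<phi>)" by simp
qed

lemma allI_const_sound:
  assumes prem: "seq_valid TYPE('a) \<Gamma> \<phi>'" and sub: "is_subst1 x (Const c) \<phi> \<phi>'"
    and fresh: "fresh_const W (\<Gamma> \<union> {\<phi>}) c"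
  shows "seq_valid TYPE('a) \<Gamma> (All1 x \<phi>)"
proof (rule seq_validI)
  fix M :: "('b, 'c, 'a) model" and X
  assume M: "total_model M" "full_team M X" and \<Gamma>: "\<forall>\<gamma>\<in>\<Gamma>. sat M X \<gamma>"
  have "sat M (team_upd X x a) \<phi>" if a: "a \<in> Dom M" for a
  proof -
    let ?N = "name_consts M [c] [a]"
    have N: "total_model ?N" "full_team ?N X"
      using M a total_name_consts[of M "[a]" "[c]"] full_team_cong[of ?N M] by auto
    have "sat ?N X \<gamma>" if "\<gamma> \<in> \<Gamma>" for \<gamma>
      using \<Gamma> fresh_constD[OF fresh, of \<gamma>] that by (simp add: sat_name_consts)
    then have "sat ?N X \<phi>'" by (intro seq_validD[OF prem N]) blast
    then show ?thesis
      using sat_subst_fresh_const[OF M a sub] fresh_constD[OF fresh] by simp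
  qed
  then show "sat M X (All1 x \<phi>)" by simp
qed

lemma incl_proj_sound:
  assumes prem: "seq_valid TYPE('a) \<Gamma> (Incl xs ys)" and js: "set js \<subseteq> {..<length xs}"
  shows "seq_valid TYPE('a) \<Gamma> (Incl (map (\<lambda>j. xs ! j) js) (map (\<lambda>j. ys ! j) js))"
proof (rule seq_validI)
  fix M :: "('b, 'c, 'a) model" and X
  assume M: "total_model M" "full_team M X" and \<Gamma>: "\<forall>\<gamma>\<in>\<Gamma>. sat M X \<gamma>"
  have "\<exists>s'\<in>X. map s (map (\<lambda>j. xs ! j) js) = map s' (map (\<lambda>j. ys ! j) js)" if "s \<in> X" for s
  proof -
    obtain s' where s': "s' \<in> X" "map s xs = map s' ys"
      using seq_validD[OF prem M \<Gamma>] \<open>s \<in> X\<close> by auto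
    have "s (xs ! j) = s' (ys ! j)" if "j \<in> set js" for j
    proof -
      have "j < length xs" "j < length ys"
        using js that map_eq_imp_length_eq[OF s'(2)] by auto
      then show ?thesis using arg_cong[OF s'(2), of "\<lambda>l. l ! j"] by simp
    qed
    then show ?thesis using s'(1) by (intro bexI[of _ s']) simp_all
  qed
  then show "sat M X (Incl (map (\<lambda>j. xs ! j) js) (map (\<lambda>j. ys ! j) js))"
    by (simp del: map_map map_eq_conv)
qed

text \<open>
  For \<open>xs \<subseteq> ys\<close> the team of values of \<open>xs\<close> is a subteam of the team of values of \<open>ys\<close>, so
  downward closure applies.
\<close>

lemma incl_compress_sound:
  assumes incl: "seq_valid TYPE('a) \<Gamma> (Incl xs ys)" and prem: "seq_valid TYPE('a) \<Gamma> \<beta>"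
    and \<alpha>: "neg_incl_free \<alpha>" "fv \<alpha> \<subseteq> set zs" and zs: "distinct zs" "length zs = length xs"
    and \<beta>: "is_subst (subst_of zs (map Var ys)) \<alpha> \<beta>"
    and \<gamma>: "is_subst (subst_of zs (map Var xs)) \<alpha> \<gamma>"
  shows "seq_valid TYPE('a) \<Gamma> \<gamma>"
proof (rule seq_validI)
  fix M :: "('b, 'c, 'a) model" and X
  assume M: "total_model M" "full_team M X" and \<Gamma>: "\<forall>\<gamma>\<in>\<Gamma>. sat M X \<gamma>"
  let ?x = "subst_of zs (map Var xs)" and ?y = "subst_of zs (map Var ys)"
  have "covered (set zs) (subst_team M ?x X) (subst_team M ?y X)"
    unfolding covered_def
  proof
    fix u assume "u \<in> subst_team M ?x X"
    then obtain s where s: "s \<in> X" "u = (\<lambda>z. Some (tval M s (?x z)))" by (auto simp: subst_team_def)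
    obtain s' where s': "s' \<in> X" "map s xs = map s' ys"
      using seq_validD[OF incl M \<Gamma>] s(1) by auto
    have len: "length xs = length ys" using s'(2) by (rule map_eq_imp_length_eq)
    have "map (tval M s) (map ?x zs) = map (\<lambda>x. the (s x)) xs"
      using zs by (simp add: map_subst_of del: map_map) simp
    also have "\<dots> = map (\<lambda>x. the (s' x)) ys"
      using map_full_team_eq_iff[OF M(2) s(1) s'(1)] s'(2) by blast
    also have "\<dots> = map (tval M s') (map ?y zs)"
      using zs len by (simp add: map_subst_of del: map_map) simp
    finally have "\<forall>z\<in>set zs. tval M s (?x z) = tval M s' (?y z)" by simp
    then show "\<exists>u'\<in>subst_team M ?y X. \<forall>z\<in>set zs. u z = u' z"
      using s(2) s'(1) by (auto simp: subst_team_def)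
  qed
  then have "covered (fv \<alpha>) (subst_team M ?x X) (subst_team M ?y X)"
    using \<alpha>(2) by (rule covered_mono)
  moreover have "sat M (subst_team M ?y X) \<alpha>"
    using seq_validD[OF prem M \<Gamma>] sat_subst[OF M(1) \<beta> M(2)] by blast
  ultimately have "sat M (subst_team M ?x X) \<alpha>" by (rule sat_downward[OF \<alpha>(1)])
  then show "sat M X \<gamma>" using sat_subst[OF M(1) \<gamma> M(2)] by blast
qed

lemma constancyD:
  assumes "total_model M" "full_team M X" "is_constancy (map Var xs) \<chi>" "sat M X \<chi>"
    and "s \<in> X" "s' \<in> X"
  shows "map s xs = map s' xs"
proof -
  have "Dom M \<noteq> {}" using assms(1) by (simp add: total_model_def)
  from sat_constancy[OF this assms(3)] obtain as where
    "\<forall>s\<in>X. map (tval M s) (map Var xs) = as"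
    using assms(4,5) by blast
  then have "map (tval M s) (map Var xs) = map (tval M s') (map Var xs)"
    using assms(5,6) by metis
  then have "map (\<lambda>x. the (s x)) xs = map (\<lambda>x. the (s' x)) xs" by simp
  then show ?thesis by (simp only: map_full_team_eq_iff[OF assms(2,5,6)])
qed

lemma incl_constancy_sound:
  assumes con: "seq_valid TYPE('a) \<Gamma> \<chi>" "is_constancy (map Var xs) \<chi>"
    and incl: "seq_valid TYPE('a) \<Gamma> (Incl ys zs)"
  shows "seq_valid TYPE('a) \<Gamma> (Incl (xs @ ys) (xs @ zs))"
proof (rule seq_validI)
  fix M :: "('b, 'c, 'a) model" and X
  assume M: "total_model M" "full_team M X" and \<Gamma>: "\<forall>\<gamma>\<in>\<Gamma>. sat M X \<gamma>"
  have "\<exists>s'\<in>X. map s (xs @ ys) = map s' (xs @ zs)" if "s \<in> X" for s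
  proof -
    obtain s' where s': "s' \<in> X" "map s ys = map s' zs"
      using seq_validD[OF incl M \<Gamma>] \<open>s \<in> X\<close> by auto
    have "map s xs = map s' xs"
      using constancyD[OF M con(2) seq_validD[OF con(1) M \<Gamma>] \<open>s \<in> X\<close> s'(1)] .
    then have "map s (xs @ ys) = map s' (xs @ zs)" using s'(2) by (simp only: map_append)
    then show ?thesis using s'(1) by blast
  qed
  then show "sat M X (Incl (xs @ ys) (xs @ zs))" unfolding sat.simps by blast
qed

lemma incl_ext_sound:
  assumes con: "seq_valid TYPE('a) \<Gamma> \<chi>" "is_constancy (map Var xs) \<chi>"
    and incl: "seq_valid TYPE('a) \<Gamma> (Incl xs ys)"
    and zs: "length zs = length ws" "distinct zs" "set zs \<inter> (set xs \<union> set ys \<union> set ws) = {}"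
  shows "seq_valid TYPE('a) \<Gamma> (Ex1s zs (Incl (zs @ xs) (ws @ ys)))"
proof (rule seq_validI)
  fix M :: "('b, 'c, 'a) model" and X
  assume M: "total_model M" "full_team M X" and \<Gamma>: "\<forall>\<gamma>\<in>\<Gamma>. sat M X \<gamma>" and "X \<noteq> {}"
  then obtain s0 where s0: "s0 \<in> X" by blast
  obtain s1 where s1: "s1 \<in> X" "map s0 xs = map s1 ys"
    using seq_validD[OF incl M \<Gamma>] s0 by auto
  \<comment> \<open>All of \<open>X\<close> has the same value of \<open>xs\<close>, so \<open>s1\<close> serves as a witness for every assignment.\<close>
  define as where "as = map (\<lambda>x. the (s1 x)) ws"
  have as: "length as = length zs" "set as \<subseteq> Dom M"
    using zs(1) full_teamD(2)[OF M(2) s1(1)] by (auto simp: as_def)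
  have old: "map (s(zs [\<mapsto>] as)) us = map s us" if "set zs \<inter> set us = {}" for s us
    using that by (auto intro!: map_cong map_upds_apply_nontin)
  have "map (s(zs [\<mapsto>] as)) (zs @ xs) = map (s1(zs [\<mapsto>] as)) (ws @ ys)" if "s \<in> X" for s
  proof -
    have "map (s(zs [\<mapsto>] as)) zs = map Some as" using zs(2) as(1) by (rule map_upds_values)
    also have "map Some as = map s1 ws"
      using full_teamD(1)[OF M(2) s1(1)] by (simp add: as_def)
    also have "\<dots> = map (s1(zs [\<mapsto>] as)) ws" using zs(3) by (intro old[symmetric]) blast
    finally have 1: "map (s(zs [\<mapsto>] as)) zs = map (s1(zs [\<mapsto>] as)) ws" .
    have "map (s(zs [\<mapsto>] as)) xs = map s xs" using zs(3) by (intro old) blast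
    also have "\<dots> = map s0 xs"
      using constancyD[OF M con(2) seq_validD[OF con(1) M \<Gamma>] \<open>s \<in> X\<close> s0] .
    also have "\<dots> = map s1 ys" by (rule s1(2))
    also have "\<dots> = map (s1(zs [\<mapsto>] as)) ys" using zs(3) by (intro old[symmetric]) blast
    finally show ?thesis using 1 by (simp only: map_append)
  qed
  then have "sat M ((\<lambda>s. s(zs [\<mapsto>] as)) ` X) (Incl (zs @ xs) (ws @ ys))"
    unfolding sat.simps using s1(1) by blast
  then show "sat M X (Ex1s zs (Incl (zs @ xs) (ws @ ys)))" unfolding sat_Ex1s using as by blast
qed

lemma sat_is_incl_named:
  assumes "total_model M" "full_team M X" "set as \<subseteq> Dom M" "length cs = length as" "distinct cs"
    and "is_incl (map Const cs) (map Var xs) \<alpha>" "X \<noteq> {}"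
  shows "sat (name_consts M cs as) X \<alpha> \<longleftrightarrow> (\<exists>s\<in>X. map (\<lambda>x. the (s x)) xs = as)"
proof -
  let ?N = "name_consts M cs as"
  have "total_model ?N" "full_team ?N X"
    using assms total_name_consts full_team_cong[of ?N M] by auto
  then have "sat ?N X \<alpha> \<longleftrightarrow>
      (\<forall>s\<in>X. \<exists>s'\<in>X. map (tval ?N s) (map Const cs) = map (tval ?N s') (map Var xs))"
    using sat_is_incl assms(6) by blast
  also have "\<dots> \<longleftrightarrow> (\<exists>s\<in>X. map (\<lambda>x. the (s x)) xs = as)"
    unfolding tval_name_consts[OF assms(4,5)] using assms(7) by (auto simp: comp_def)
  finally show ?thesis .
qed

text \<open>
  Some assignment \<open>s\<close> of the team has a value of \<open>xs\<close> that \<open>ys\<close> never takes; the constant symbols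
  are made names of this value, which is possible for arbitrary tuples as the symbols are distinct.
\<close>

lemma not_inclE_sound:
  assumes neg: "seq_valid TYPE('a) \<Gamma> (Neg (Incl xs ys))"
    and \<alpha>: "is_incl (map Const cs) (map Var xs) \<alpha>" and \<beta>: "is_incl (map Const cs) (map Var ys) \<beta>"
    and prem: "seq_valid TYPE('a) (insert (Neg \<beta>) (insert \<alpha> \<Gamma>)) \<phi>"
    and cs: "length cs = length xs" "distinct cs"
    and fresh: "\<forall>c\<in>set cs. fresh_const W (\<Gamma> \<union> {\<phi>}) c"
  shows "seq_valid TYPE('a) \<Gamma> \<phi>"
proof (rule seq_validI)
  fix M :: "('b, 'c, 'a) model" and X
  assume M: "total_model M" "full_team M X" and \<Gamma>: "\<forall>\<gamma>\<in>\<Gamma>. sat M X \<gamma>" and X: "X \<noteq> {}"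
  obtain s where s: "s \<in> X" "\<forall>s'\<in>X. map s xs \<noteq> map s' ys"
    using seq_validD[OF neg M \<Gamma>] X by auto
  define as where "as = map (\<lambda>x. the (s x)) xs"
  let ?N = "name_consts M cs as"
  have as: "set as \<subseteq> Dom M" "length cs = length as"
    using full_teamD(2)[OF M(2) s(1)] cs(1) by (auto simp: as_def)
  have N: "total_model ?N" "full_team ?N X"
    using M as total_name_consts full_team_cong[of ?N M] by auto
  have same: "sat ?N X \<theta> \<longleftrightarrow> sat M X \<theta>" if "\<theta> \<in> \<Gamma> \<union> {\<phi>}" for \<theta>
    using fresh fresh_constD[OF _ that] by (intro sat_name_consts) blast
  have "sat ?N X \<alpha>"
    unfolding sat_is_incl_named[OF M as cs(2) \<alpha> X] using s(1) as_def by blast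
  moreover have "map (\<lambda>x. the (s' x)) ys \<noteq> as" if "s' \<in> X" for s'
    using s(2) that map_full_team_eq_iff[OF M(2) s(1) that, of xs ys] unfolding as_def by metis
  then have "\<not> sat ?N X \<beta>" unfolding sat_is_incl_named[OF M as cs(2) \<beta> X] by blast
  ultimately have "sat ?N X \<phi>" using \<Gamma> same by (intro seq_validD[OF prem N]) auto
  then show "sat M X \<phi>" using same by simp
qed

lemma sat_atom_flat: "is_atom \<theta> \<Longrightarrow> sat M X \<theta> \<longleftrightarrow> (\<forall>s\<in>X. sat M {s} \<theta>)"
  by (auto simp: is_atom_def)

text \<open>
  Atoms are flat, that is, true in a team iff true in each of its assignments. The constant symbols
  name the values of \<open>xs\<close> under an assignment of the team that makes the atom false.
\<close>

lemma not_atomE_sound: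
  assumes atom: "is_atom \<theta>" and zs: "fv \<theta> \<subseteq> set zs" "distinct zs" "length xs = length zs"
    and \<theta>x: "is_subst (subst_of zs (map Var xs)) \<theta> \<theta>x"
    and \<theta>c: "is_subst (subst_of zs (map Const cs)) \<theta> \<theta>c"
    and neg: "seq_valid TYPE('a) \<Gamma> (Neg \<theta>x)"
    and \<alpha>: "is_incl (map Const cs) (map Var xs) \<alpha>"
    and prem: "seq_valid TYPE('a) (insert (Neg \<theta>c) (insert \<alpha> \<Gamma>)) \<phi>"
    and cs: "length cs = length xs" "distinct cs"
    and fresh: "\<forall>c\<in>set cs. fresh_const W (\<Gamma> \<union> {\<phi>, \<theta>}) c"
  shows "seq_valid TYPE('a) \<Gamma> \<phi>"
proof (rule seq_validI)
  fix M :: "('b, 'c, 'a) model" and X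
  assume M: "total_model M" "full_team M X" and \<Gamma>: "\<forall>\<gamma>\<in>\<Gamma>. sat M X \<gamma>" and X: "X \<noteq> {}"
  let ?x = "subst_of zs (map Var xs)" and ?c = "subst_of zs (map Const cs)"
  have "\<not> sat M X \<theta>x" using seq_validD[OF neg M \<Gamma>] X by auto
  then have "\<not> sat M (subst_team M ?x X) \<theta>" using sat_subst[OF M(1) \<theta>x M(2)] by blast
  then obtain s where s: "s \<in> X" "\<not> sat M {\<lambda>z. Some (tval M s (?x z))} \<theta>"
    using sat_atom_flat[OF atom, of M "subst_team M ?x X"] by (auto simp: subst_team_def)
  define as where "as = map (\<lambda>x. the (s x)) xs"
  let ?N = "name_consts M cs as"
  have as: "set as \<subseteq> Dom M" "length cs = length as"
    using full_teamD(2)[OF M(2) s(1)] cs(1) by (auto simp: as_def)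
  have N: "total_model ?N" "full_team ?N X"
    using M as total_name_consts full_team_cong[of ?N M] by auto
  have same: "sat ?N Y \<psi> \<longleftrightarrow> sat M Y \<psi>" if "\<psi> \<in> \<Gamma> \<union> {\<phi>, \<theta>}" for Y \<psi>
    using fresh fresh_constD[OF _ that] by (intro sat_name_consts) blast
  have "map (tval ?N s) (map ?c zs) = as"
    using zs cs tval_name_consts[OF as(2) cs(2), of M s] by (simp add: map_subst_of del: map_map)
  also have "\<dots> = map (tval M s) (map ?x zs)"
    using zs by (simp add: map_subst_of as_def del: map_map) simp
  finally have eq: "\<forall>z\<in>set zs. tval ?N s (?c z) = tval M s (?x z)" by simp
  have "sat M {\<lambda>z. Some (tval ?N s (?c z))} \<theta> \<longleftrightarrow> sat M {\<lambda>z. Some (tval M s (?x z))} \<theta>"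
    using eq zs(1) by (intro sat_cong_team) (auto simp: covered_def)
  then have "\<not> sat ?N {\<lambda>z. Some (tval ?N s (?c z))} \<theta>" using s(2) same by simp
  then have "\<not> sat ?N (subst_team ?N ?c X) \<theta>"
    using s(1) sat_atom_flat[OF atom, of ?N "subst_team ?N ?c X"] by (auto simp: subst_team_def)
  then have "sat ?N X (Neg \<theta>c)" using sat_subst[OF N(1) \<theta>c N(2)] by simp
  moreover have "sat ?N X \<alpha>"
    unfolding sat_is_incl_named[OF M as cs(2) \<alpha> X] using s(1) as_def by blast
  ultimately have "sat ?N X \<phi>" using \<Gamma> same by (intro seq_validD[OF prem N]) auto
  then show "sat M X \<phi>" using same by simp
qed

lemma tval_rel_int_upd [simp]: "tval (M\<lparr>rel_int := I\<rparr>) = tval M"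
  by (intro ext tval_cong_model) simp

lemma values_team_upd:
  assumes "y \<notin> set vs"
  shows "(\<lambda>s. map (\<lambda>v. the (s v)) vs) ` team_upd X y a = (\<lambda>s. map (\<lambda>v. the (s v)) vs) ` X"
proof -
  have "map (\<lambda>v. the ((s(y \<mapsto> a)) v)) vs = map (\<lambda>v. the (s v)) vs" for s
    using assms by (auto intro!: map_cong)
  then show ?thesis unfolding team_upd_image image_image by (rule image_cong[OF refl])
qed

text \<open>
  The formula is evaluated in the changed teams \<open>X(a/y)\<close>, whereas the interpretation of \<open>R\<close> is fixed
  once, as the set \<open>D\<close> of values of \<open>vs\<close> in the initial team. Since the inserted variables \<open>vs\<close> are
  never captured, the set of their values stays \<open>D\<close> for as long as \<open>R\<close> occurs.
\<close>

lemma sat_rel_to_incl: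
  "rel_to_incl R vs \<phi> \<psi> \<Longrightarrow> full_team M X \<Longrightarrow>
    (R \<in> fm_rels \<phi> \<Longrightarrow> (\<lambda>s. map (\<lambda>v. the (s v)) vs) ` X = D) \<Longrightarrow>
    sat (M\<lparr>rel_int := (rel_int M)(R := \<lambda>bs. bs \<in> D)\<rparr>) X \<phi> \<longleftrightarrow> sat M X \<psi>"
proof (induction arbitrary: X rule: rel_to_incl.induct)
  case (3 xs)
  then have D: "D = (\<lambda>s. map (\<lambda>v. the (s v)) vs) ` X" by simp
  have "map (\<lambda>x. the (s x)) xs \<in> D \<longleftrightarrow> (\<exists>s'\<in>X. map s xs = map s' vs)" if "s \<in> X" for s
    unfolding D using map_full_team_eq_iff[OF 3(1) that] by auto
  then show ?case by (simp add: comp_def)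
next
  case (7 \<phi> \<phi>' y)
  have "sat (M\<lparr>rel_int := (rel_int M)(R := \<lambda>bs. bs \<in> D)\<rparr>) (team_upd X y a) \<phi> \<longleftrightarrow>
      sat M (team_upd X y a) \<phi>'" if "a \<in> Dom M" for a
  proof (rule "7.IH")
    show "full_team M (team_upd X y a)" using "7.prems"(1) that by (rule full_team_upd)
    assume "R \<in> fm_rels \<phi>"
    then show "(\<lambda>s. map (\<lambda>v. the (s v)) vs) ` team_upd X y a = D"
      using "7.hyps"(2) "7.prems"(2) by (simp add: values_team_upd)
  qed
  then show ?case by (simp del: fun_upd_apply)
next
  case (8 \<phi> \<phi>' y)
  have "sat (M\<lparr>rel_int := (rel_int M)(R := \<lambda>bs. bs \<in> D)\<rparr>) (team_upd X y a) \<phi> \<longleftrightarrow>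
      sat M (team_upd X y a) \<phi>'" if "a \<in> Dom M" for a
  proof (rule "8.IH")
    show "full_team M (team_upd X y a)" using "8.prems"(1) that by (rule full_team_upd)
    assume "R \<in> fm_rels \<phi>"
    then show "(\<lambda>s. map (\<lambda>v. the (s v)) vs) ` team_upd X y a = D"
      using "8.hyps"(2) "8.prems"(2) by (simp add: values_team_upd)
  qed
  then show ?case by (simp del: fun_upd_apply)
qed simp_all

text \<open>
  A nonempty team satisfying \<open>\<phi>(vs)\<close> would yield a nonempty interpretation of \<open>R\<close> with \<open>\<phi>(R)\<close>, hence
  a model in which the premise fails for that same team.
\<close>

lemma rel_elim_sound:
  assumes prem: "seq_valid TYPE('a) (insert \<phi> (insert (Ex1s zs (Rel R (map Var zs))) \<Gamma>)) Bot"
    and zs: "length zs = length vs" "distinct zs"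
    and fresh: "\<forall>\<gamma>\<in>\<Gamma>. R \<notin> fm_rels \<gamma>" and \<psi>: "rel_to_incl R vs \<phi> \<psi>"
  shows "seq_valid TYPE('a) (insert \<psi> \<Gamma>) Bot"
proof (rule seq_validI)
  fix M :: "('b, 'c, 'a) model" and X
  assume M: "total_model M" "full_team M X" and \<Gamma>: "\<forall>\<gamma>\<in>insert \<psi> \<Gamma>. sat M X \<gamma>"
    and "X \<noteq> {}"
  then obtain s where s: "s \<in> X" by blast
  define D where "D = (\<lambda>s. map (\<lambda>v. the (s v)) vs) ` X"
  let ?N = "M\<lparr>rel_int := (rel_int M)(R := \<lambda>bs. bs \<in> D)\<rparr>"
  have N: "total_model ?N" "full_team ?N X"
    using M full_team_cong[of ?N M] by (auto simp: total_model_def)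
  have "sat ?N X \<phi>" using sat_rel_to_incl[OF \<psi> M(2)] \<Gamma> by (simp add: D_def)
  moreover have "sat ?N X \<gamma>" if "\<gamma> \<in> \<Gamma>" for \<gamma>
  proof -
    have "sat ?N X \<gamma> \<longleftrightarrow> sat M X \<gamma>" using fresh that by (intro sat_cong_model) auto
    then show ?thesis using \<Gamma> that by simp
  qed
  moreover have "sat ?N X (Ex1s zs (Rel R (map Var zs)))"
  proof -
    let ?as = "map (\<lambda>v. the (s v)) vs"
    have "map (tval ?N (s'(zs [\<mapsto>] ?as))) (map Var zs) = ?as" for s'
    proof -
      have "map (tval ?N (s'(zs [\<mapsto>] ?as))) (map Var zs) = map the (map (s'(zs [\<mapsto>] ?as)) zs)"
        by simp
      also have "\<dots> = ?as" using zs by (subst map_upds_values) simp_all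
      finally show ?thesis .
    qed
    moreover have "?as \<in> D" using s by (auto simp: D_def)
    ultimately have "sat ?N ((\<lambda>s. s(zs [\<mapsto>] ?as)) ` X) (Rel R (map Var zs))"
      by (simp del: map_map tval_rel_int_upd)
    then show ?thesis
      unfolding sat_Ex1s using zs(1) full_teamD(2)[OF N(2) s]
      by (intro exI[of _ ?as]) auto
  qed
  ultimately have "sat ?N X Bot" by (intro seq_validD[OF prem N]) auto
  then show "sat M X Bot" using N(1) M(1) by (simp add: sat_Bot total_model_def)
qed

theorem deriv_sound:
  "deriv W \<Gamma> \<phi> \<Longrightarrow> seq_valid TYPE('a) \<Gamma> \<phi>"
proof (induction rule: deriv.induct)
  case (assm \<phi> \<Gamma>)
  then show ?case by (simp add: seq_valid_def)
next
  case (eq_refl t \<Gamma>)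
  show ?case by (rule seq_validI) simp
next
  case (eq_subst \<Gamma> t t' \<psi> x \<phi> \<psi>')
  show ?case
  proof (rule seq_validI)
    fix M :: "('b, 'c, 'a) model" and X
    assume M: "total_model M" "full_team M X" and \<Gamma>: "\<forall>\<gamma>\<in>\<Gamma>. sat M X \<gamma>"
    have "\<forall>s\<in>X. tval M s t = tval M s t'" using seq_validD[OF eq_subst.IH(1) M \<Gamma>] by simp
    then have "(\<lambda>y. Some (tval M s ((Var(x := t)) y))) = (\<lambda>y. Some (tval M s ((Var(x := t')) y)))"
      if "s \<in> X" for s
      using that by (auto simp: fun_eq_iff)
    then have "subst_team M (Var(x := t)) X = subst_team M (Var(x := t')) X"
      unfolding subst_team_def by (rule image_cong[OF refl])
    then show "sat M X \<psi>'"
      using seq_validD[OF eq_subst.IH(2) M \<Gamma>] sat_subst[OF M(1) eq_subst.hyps(3) M(2)]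
        sat_subst[OF M(1) eq_subst.hyps(4) M(2)] by simp
  qed
next
  case (andI \<Gamma> \<phi> \<psi>)
  then show ?case by (simp add: seq_valid_def)
next
  case (andE1 \<Gamma> \<phi> \<psi>)
  then show ?case by (simp add: seq_valid_def)
next
  case (andE2 \<Gamma> \<phi> \<psi>)
  then show ?case by (simp add: seq_valid_def)
next
  case (orI1 \<Gamma> \<phi> \<psi>)
  then show ?case by (simp add: seq_valid_def)
next
  case (orI2 \<Gamma> \<phi> \<psi>)
  then show ?case by (simp add: seq_valid_def)
next
  case (orE \<Gamma> \<phi> \<psi> \<chi>)
  show ?case
  proof (rule seq_validI)
    fix M :: "('b, 'c, 'a) model" and X
    assume M: "total_model M" "full_team M X" and \<Gamma>: "\<forall>\<gamma>\<in>\<Gamma>. sat M X \<gamma>"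
    have "sat M X \<phi> \<or> sat M X \<psi>" using seq_validD[OF orE.IH(1) M \<Gamma>] by simp
    then show "sat M X \<chi>"
      using seq_validD[OF orE.IH(2) M] seq_validD[OF orE.IH(3) M] \<Gamma> by blast
  qed
next
  case (exI1 \<Gamma> \<psi> x t \<phi> \<chi>)
  show ?case
  proof (rule seq_validI)
    fix M :: "('b, 'c, 'a) model" and X
    assume M: "total_model M" "full_team M X" and \<Gamma>: "\<forall>\<gamma>\<in>\<Gamma>. sat M X \<gamma>" and X: "X \<noteq> {}"
    have "Dom M \<noteq> {}" using M(1) by (simp add: total_model_def)
    from sat_constancy1[OF this exI1.hyps(4)] obtain a where a: "a \<in> Dom M" "\<forall>s\<in>X. tval M s t = a"
      using seq_validD[OF exI1.IH(2) M \<Gamma>] X by blast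
    then show "sat M X (Ex1 x \<phi>)"
      using sat_subst1[OF M exI1.hyps(2) a(2)] seq_validD[OF exI1.IH(1) M \<Gamma>] by auto
  qed
next
  case (exE_var \<Gamma> x \<phi> v \<phi>' \<chi> \<psi>)
  show ?case
    by (rule exE_var_sound[OF exE_var.IH(1) exE_var.hyps(2,3) exE_var.IH(2) exE_var.hyps(5)])
next
  case (exE_const \<Gamma> x \<phi> c \<phi>' \<psi>)
  show ?case
    by (rule exE_const_sound[OF exE_const.IH(1) exE_const.hyps(2) exE_const.IH(2) exE_const.hyps(4)])
next
  case (allI_var \<chi> \<Gamma> \<phi>' v x \<phi>)
  show ?case
    by (rule allI_var_sound[OF allI_var.IH allI_var.hyps(2-4)])
next
  case (allI_const \<Gamma> \<phi>' x c \<phi>)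
  show ?case
    by (rule allI_const_sound[OF allI_const.IH allI_const.hyps(2,3)])
next
  case (allE1 \<Gamma> x \<phi> \<chi> t \<psi>)
  show ?case
  proof (rule seq_validI)
    fix M :: "('b, 'c, 'a) model" and X
    assume M: "total_model M" "full_team M X" and \<Gamma>: "\<forall>\<gamma>\<in>\<Gamma>. sat M X \<gamma>" and X: "X \<noteq> {}"
    have "Dom M \<noteq> {}" using M(1) by (simp add: total_model_def)
    from sat_constancy1[OF this allE1.hyps(3)] obtain a where a: "a \<in> Dom M" "\<forall>s\<in>X. tval M s t = a"
      using seq_validD[OF allE1.IH(2) M \<Gamma>] X by blast
    then show "sat M X \<psi>"
      using sat_subst1[OF M allE1.hyps(4) a(2)] seq_validD[OF allE1.IH(1) M \<Gamma>] by simp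
  qed
next
  case (negI \<phi> \<Gamma>)
  show ?case
  proof (rule seq_validI)
    fix M :: "('b, 'c, 'a) model" and X
    assume M: "total_model M" "full_team M X" and \<Gamma>: "\<forall>\<gamma>\<in>\<Gamma>. sat M X \<gamma>" and X: "X \<noteq> {}"
    have "\<not> sat M X Bot" using M(1) X by (simp add: total_model_def sat_Bot)
    then have "\<not> sat M X \<phi>" using seq_validD[OF negI.IH M] \<Gamma> by auto
    then show "sat M X (Neg \<phi>)" by simp
  qed
next
  case (negE \<Gamma> \<phi> \<psi>)
  show ?case
  proof (rule seq_validI)
    fix M :: "('b, 'c, 'a) model" and X
    assume M: "total_model M" "full_team M X" and \<Gamma>: "\<forall>\<gamma>\<in>\<Gamma>. sat M X \<gamma>" and "X \<noteq> {}"
    then show "sat M X \<psi>"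
      using seq_validD[OF negE.IH(1) M \<Gamma>] seq_validD[OF negE.IH(2) M \<Gamma>] by simp
  qed
next
  case (raa \<phi> \<Gamma>)
  show ?case
  proof (rule seq_validI)
    fix M :: "('b, 'c, 'a) model" and X
    assume M: "total_model M" "full_team M X" and \<Gamma>: "\<forall>\<gamma>\<in>\<Gamma>. sat M X \<gamma>" and X: "X \<noteq> {}"
    have "\<not> sat M X Bot" using M(1) X by (simp add: total_model_def sat_Bot)
    then have "\<not> sat M X (Neg \<phi>)" using seq_validD[OF raa.IH M] \<Gamma> by auto
    then show "sat M X \<phi>" by simp
  qed
next
  case (constancy_const cs \<chi> \<Gamma>)
  show ?case
  proof (rule seq_validI)
    fix M :: "('b, 'c, 'a) model" and X
    assume M: "total_model M"
    have D: "Dom M \<noteq> {}" using M by (simp add: total_model_def)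
    have "set (map (\<lambda>c. fun_int M c []) cs) \<subseteq> Dom M"
      using total_model_const[OF M] by auto
    then show "sat M X \<chi>"
      unfolding sat_constancy[OF D constancy_const.hyps(2)]
      by (intro disjI2 exI[of _ "map (\<lambda>c. fun_int M c []) cs"]) simp
  qed
next
  case (constancy_fun \<Gamma> \<chi> ts f \<chi>')
  show ?case
  proof (rule seq_validI)
    fix M :: "('b, 'c, 'a) model" and X
    assume M: "total_model M" "full_team M X" and \<Gamma>: "\<forall>\<gamma>\<in>\<Gamma>. sat M X \<gamma>" and X: "X \<noteq> {}"
    have D: "Dom M \<noteq> {}" using M(1) by (simp add: total_model_def)
    from sat_constancy[OF this constancy_fun.hyps(2)] obtain as
      where as: "set as \<subseteq> Dom M" "\<forall>s\<in>X. map (tval M s) ts = as"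
      using seq_validD[OF constancy_fun.IH M \<Gamma>] X by blast
    have "\<forall>s\<in>X. tval M s (Fun f ts) = fun_int M f as" using as(2) by simp
    moreover have "fun_int M f as \<in> Dom M" using M(1) as(1) by (simp add: total_model_def)
    ultimately show "sat M X \<chi>'"
      unfolding sat_constancy1[OF D constancy_fun.hyps(4)] by blast
  qed
next
  case (incl_refl \<Gamma> xs)
  show ?case by (rule seq_validI) auto
next
  case (incl_trans \<Gamma> xs ys zs)
  show ?case
  proof (rule seq_validI)
    fix M :: "('b, 'c, 'a) model" and X
    assume M: "total_model M" "full_team M X" and \<Gamma>: "\<forall>\<gamma>\<in>\<Gamma>. sat M X \<gamma>"
    show "sat M X (Incl xs zs)"
      using seq_validD[OF incl_trans.IH(1) M \<Gamma>] seq_validD[OF incl_trans.IH(2) M \<Gamma>]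
      unfolding sat.simps by metis
  qed
next
  case (incl_proj \<Gamma> xs ys js)
  show ?case
    by (rule incl_proj_sound[OF incl_proj.IH incl_proj.hyps(2)])
next
  case (incl_compress \<Gamma> xs ys \<beta> \<alpha> zs \<gamma>)
  show ?case
    by (rule incl_compress_sound[OF incl_compress.IH incl_compress.hyps(3-8)])
next
  case (incl_constancy \<Gamma> \<chi> xs ys zs)
  show ?case
    by (rule incl_constancy_sound[OF incl_constancy.IH(1) incl_constancy.hyps(2) incl_constancy.IH(2)])
next
  case (incl_ext \<Gamma> \<chi> xs ys zs ws)
  show ?case
    by (rule incl_ext_sound[OF incl_ext.IH(1) incl_ext.hyps(2) incl_ext.IH(2) incl_ext.hyps(4-6)])
next
  case (not_inclE \<Gamma> xs ys cs \<alpha> \<beta> \<phi>)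
  show ?case
    by (rule not_inclE_sound[OF not_inclE.IH(1) not_inclE.hyps(2,3) not_inclE.IH(2) not_inclE.hyps(5-7)])
next
  case (not_atomE \<theta> zs xs \<theta>x cs \<theta>c \<Gamma> \<alpha> \<phi>)
  show ?case
    by (rule not_atomE_sound[OF not_atomE.hyps(1-6) not_atomE.IH(1) not_atomE.hyps(8) not_atomE.IH(2) not_atomE.hyps(10-12)])
next
  case (rel_elim \<phi> zs R \<Gamma> vs \<psi>)
  have "\<forall>\<gamma>\<in>\<Gamma>. R \<notin> fm_rels \<gamma>" using rel_elim.hyps(5) by blast
  then show ?case
    by (rule rel_elim_sound[OF rel_elim.IH rel_elim.hyps(3,4) _ rel_elim.hyps(8)])
qed


section \<open>Passing to the extended vocabulary\<close>

text \<open>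
  A model of \<open>L\<close> becomes a model of the extended vocabulary in which all function symbols are
  interpreted by operations on the domain: values outside the domain, which only ill-formed terms
  can have, are replaced by \<open>a\<close>.
\<close>

definition ext_model ::
    "('f, 'r, 'a) model \<Rightarrow> 'a \<Rightarrow> ('f ext_fun, 'r ext_rel, 'a) model" where
  "ext_model M a =
     \<lparr> Dom = Dom M,
       fun_int = case_ext_fun (\<lambda>f as. if fun_int M f as \<in> Dom M then fun_int M f as else a)
         (\<lambda>i as. a),
       rel_int = case_ext_rel (rel_int M) (\<lambda>n i as. False) \<rparr>"

lemma ext_model_simps [simp]:
  "Dom (ext_model M a) = Dom M"
  "fun_int (ext_model M a) (OldFun f) as = (if fun_int M f as \<in> Dom M then fun_int M f as else a)"
  "fun_int (ext_model M a) (NewConst i) as = a"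
  "rel_int (ext_model M a) (OldRel r) = rel_int M r"
  by (simp_all add: ext_model_def)

lemma total_ext_model: "a \<in> Dom M \<Longrightarrow> total_model (ext_model M a)"
  unfolding total_model_def
proof (intro conjI allI impI)
  fix f as assume "a \<in> Dom M"
  then show "fun_int (ext_model M a) f as \<in> Dom (ext_model M a)" by (cases f) simp_all
qed auto

lemma tval_ext_model:
  assumes "is_model L M" "full_team M X" "s \<in> X"
  shows "wf_tm L t \<Longrightarrow> tval (ext_model M a) s (map_tm OldFun t) = tval M s t \<and> tval M s t \<in> Dom M"
proof (induction t)
  case (Var x)
  then show ?case using full_teamD(2)[OF assms(2,3)] by simp
next
  case (Fun f ts)
  have ts: "map (tval (ext_model M a) s) (map (map_tm OldFun) ts) = map (tval M s) ts"
    "set (map (tval M s) ts) \<subseteq> Dom M"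
    using Fun by auto
  have "fun_int M f (map (tval M s) ts) \<in> Dom M"
    using assms(1) Fun.prems ts(2) by (simp add: is_model_def)
  then show ?case using ts(1) by (simp del: map_map map_eq_conv)
qed

lemma sat_ext_model:
  assumes "is_model L M"
  shows "wf_fm L \<phi> \<Longrightarrow> full_team M X \<Longrightarrow> sat (ext_model M a) X (ext_fm \<phi>) \<longleftrightarrow> sat M X \<phi>"
proof (induction \<phi> arbitrary: X)
  case (Eq t t')
  then show ?case using tval_ext_model[OF assms Eq.prems(2)] by simp
next
  case (Rel r ts)
  have "map (tval (ext_model M a) s) (map (map_tm OldFun) ts) = map (tval M s) ts" if "s \<in> X" for s
    using tval_ext_model[OF assms Rel.prems(2) that] Rel.prems(1) by simp
  then show ?case by (simp del: map_map map_eq_conv)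
qed (simp_all add: full_team_upd)

text \<open>
  Derivations may involve variables outside the domain \<open>V\<close> of the given team; these receive a
  default value.
\<close>

lemma sat_total_team:
  assumes "fv \<phi> \<subseteq> V"
  shows "sat M ((\<lambda>s x. if x \<in> V then s x else b) ` X) \<phi> \<longleftrightarrow> sat M X \<phi>"
  using assms by (intro sat_cong_team) (fastforce simp: covered_def)+

theorem theorem4p2:
  fixes L :: "('f, 'r) vocab" and \<Gamma> :: "('f, 'r) fm set" and \<phi> :: "('f, 'r) fm"
  assumes "\<Gamma> \<union> {\<phi>} \<subseteq> FOT L"
    and "derives L \<Gamma> \<phi>"
  shows "entails TYPE('a) L \<Gamma> \<phi>"
  unfolding entails_def
proof (intro allI impI, elim conjE)
  fix M :: "('f, 'r, 'a) model" and V X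
  assume M: "is_model L M" and X: "is_team M V X" and V: "(\<Union>\<psi>\<in>\<Gamma> \<union> {\<phi>}. fv \<psi>) \<subseteq> V"
    and \<Gamma>: "\<forall>\<psi>\<in>\<Gamma>. sat M X \<psi>"
  obtain a where a: "a \<in> Dom M" using M by (auto simp: is_model_def)
  let ?N = "ext_model M a" and ?Y = "(\<lambda>s x. if x \<in> V then s x else Some a) ` X"
  have Y: "full_team M ?Y"
  proof (rule full_teamI)
    fix u x assume "u \<in> ?Y"
    then obtain s where s: "s \<in> X" "u = (\<lambda>x. if x \<in> V then s x else Some a)" by blast
    then have "dom s = V" "ran s \<subseteq> Dom M" using X by (auto simp: is_team_def)
    then show "\<exists>b\<in>Dom M. u x = Some b" using s(2) a by (auto simp: ran_def)
  qed
  have same: "sat ?N ?Y (ext_fm \<psi>) \<longleftrightarrow> sat M X \<psi>" if "\<psi> \<in> \<Gamma> \<union> {\<phi>}" for \<psi>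
  proof -
    have "wf_fm L \<psi>" "fv \<psi> \<subseteq> V" using assms(1) V that by (auto simp: FOT_def)
    then show ?thesis using sat_ext_model[OF M _ Y] sat_total_team by blast
  qed
  have "seq_valid TYPE('a) (ext_fm ` \<Gamma>) (ext_fm \<phi>)"
    using assms(2) unfolding derives_def by (rule deriv_sound)
  moreover have "total_model ?N" "full_team ?N ?Y"
    using total_ext_model[OF a] Y full_team_cong[of ?N M] by auto
  moreover have "\<forall>\<psi>\<in>ext_fm ` \<Gamma>. sat ?N ?Y \<psi>" using \<Gamma> same by auto
  ultimately have "sat ?N ?Y (ext_fm \<phi>)" by (rule seq_validD)
  then show "sat M X \<phi>" using same by simp
qed

end
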